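(* Let $\mathcal P:U\rightrightarrows V$ be a pair of linear mappings $\mathcal A,\mathcal B:U\to V$ between finite-dimensional vector spaces over a field $\mathbb F$. Construct pairs $\mathcal P_{ij}=(\mathcal A_{ij},\mathcal B_{ij})$, $\mathcal A_{ij},\mathcal B_{ij}:U_{ij}\to V_{ij}$, for $i=1,2,3$ and $j\ge1$ as follows. Put $\mathcal P_{11}=\mathcal P$. For all $j\ge 1$: (i) $U_{1,j+1}=\mathcal A_{1j}^{-1}(\operatorname{im}\mathcal B_{1j})$, $V_{1,j+1}=\operatorname{im}\mathcal B_{1j}$, with $\mathcal A_{1,j+1},\mathcal B_{1,j+1}$ the restrictions of $\mathcal A_{1j},\mathcal B_{1j}$; (ii) $U_{2,j+1}=\mathcal B_{2j}^{-1}(\operatorname{im}\mathcal A_{2j})$, $V_{2,j+1}=\operatorname{im}\mathcal A_{2j}$, with $\mathcal A_{2,j+1},\mathcal B_{2,j+1}$ the restrictions of $\mathcal A_{2j},\mathcal B_{2j}$; (iii) $U_{3,j+1}=U_{3j}/\operatorname{Ker}\mathcal B_{3j}$, $V_{3,j+1}=V_{3j}/\mathcal A_{3j}(\operatorname{Ker}\mathcal B_{3j})$, with $\mathcal A_{3,j+1},\mathcal B_{3,j+1}$ the maps induced by $\mathcal A_{3j},\mathcal B_{3j}$. Let $\ell_1$ be the least $j$ such that $\mathcal B_{1j}$ is surjective, and set $\mathcal P_{21}=\mathcal P_{1\ell_1}$; let $\ell_2$ be the least $j$ such that $\mathcal A_{2j}$ is surjective, and set $\mathcal P_{31}=\mathcal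 P_{2\ell_2}$; let $\ell_3$ be the least $j$ such that $\mathcal B_{3j}$ is bijective. Then there exist bases of $U$ and $V$ in which $(\mathcal A,\mathcal B)$ is given by the direct sum of the following matrix pairs: - a pair of nonsingular matrices giving $\mathcal P_{3\ell_3}=(\mathcal A_{3\ell_3},\mathcal B_{3\ell_3})$ (both maps are bijective); - $(\dim V_{1j}-\dim V_{1,j+1})-(\dim U_{1j}-\dim U_{1,j+1})$ copies of $(L_j^T,R_j^T)$, for $1\le j<\ell_1$; - $(\dim U_{1j}-\dim U_{1,j+1})-(\dim V_{1,j+1}-\dim V_{1,j+2})$ copies of $(I_j,J_j(0))$, for $1\le j<\ell_1$; - $\dim V_{2j}-2\dim V_{2,j+1}+\dim V_{2,j+2}$ copies of $(J_j(0),I_j)$, for $1\le j<\ell_2$; - $\dim U_{3j}-2\dim U_{3,j+1}+\dim U_{3,j+2}$ copies of $(L_j,R_j)$, for $1\le j<\ell_3$. This direct sum is a regularizing decomposition of every matrix pair that gives $\mathcal P$ in some bases of $U$ and $V$.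
   Context: $J_k(0)$ denotes the $k\times k$ nilpotent Jordan block with ones directly below the diagonal. $L_k$ and $R_k$ are the $(k-1)\times k$ matrices obtained from $I_k$ by deleting its last row, respectively its first row ($L_1=R_1$ is the $0\times1$ matrix, $L_1^T=R_1^T$ the $1\times 0$ matrix). Direct sums of matrix pairs are taken blockwise: $(A,B)\oplus(A',B')=(A\oplus A',B\oplus B')$. Two matrix pairs $(A,B)$, $(A',B')$ are equivalent if $SA=A'R$ and $SB=B'R$ for some nonsingular $S,R$. A regularizing decomposition of a matrix pair $(A,B)$ is a direct sum $(I_r,D)\oplus(M_1,N_1)\oplus\dots\oplus(M_t,N_t)$ equivalent to $(A,B)$, in which $D$ is $r\times r$ nonsingular and each $(M_i,N_i)$ is one of $(I_k,J_k(0))$, $(J_k(0),I_k)$, $(L_k,R_k)$, $(L_k^T,R_k^T)$, $k\ge1$. *)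

theory Defs
  imports Main "Jordan_Normal_Form.Matrix"
begin

text \<open>L_k, R_k: (k-1) x k, obtained from I_k by deleting the last resp. first row.
  J_k(0): k x k nilpotent Jordan block with ones directly below the diagonal.\<close>

definition Lmat :: "nat \<Rightarrow> 'a::{zero,one} mat" where
  "Lmat k = mat (k - 1) k (\<lambda>(i, j). if j = i then 1 else 0)"

definition Rmat :: "nat \<Rightarrow> 'a::{zero,one} mat" where
  "Rmat k = mat (k - 1) k (\<lambda>(i, j). if j = i + 1 then 1 else 0)"

definition Jmat :: "nat \<Rightarrow> 'a::{zero,one} mat" where
  "Jmat k = mat k k (\<lambda>(i, j). if i = j + 1 then 1 else 0)"

definition pair_dsum :: "'a::zero mat \<times> 'a mat \<Rightarrow> 'a mat \<times> 'a mat \<Rightarrow> 'a mat \<times> 'a mat" where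
  "pair_dsum P Q = (case P of (A, B) \<Rightarrow> case Q of (A', B') \<Rightarrow>
     (four_block_mat A (0\<^sub>m (dim_row A) (dim_col A')) (0\<^sub>m (dim_row A') (dim_col A)) A',
      four_block_mat B (0\<^sub>m (dim_row B) (dim_col B')) (0\<^sub>m (dim_row B') (dim_col B)) B'))"

definition pair_dsum_list :: "('a::zero mat \<times> 'a mat) list \<Rightarrow> 'a mat \<times> 'a mat" where
  "pair_dsum_list ps = foldr pair_dsum ps (0\<^sub>m 0 0, 0\<^sub>m 0 0)"

definition pair_equiv :: "'a::comm_ring_1 mat \<times> 'a mat \<Rightarrow> 'a mat \<times> 'a mat \<Rightarrow> bool" where
  "pair_equiv P Q = (case P of (A, B) \<Rightarrow> case Q of (A', B') \<Rightarrow>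
     B \<in> carrier_mat (dim_row A) (dim_col A) \<and> B' \<in> carrier_mat (dim_row A') (dim_col A') \<and>
     (\<exists>S R. S \<in> carrier_mat (dim_row A') (dim_row A) \<and> R \<in> carrier_mat (dim_col A') (dim_col A) \<and>
        invertible_mat S \<and> invertible_mat R \<and> S * A = A' * R \<and> S * B = B' * R))"

definition canonical_block :: "'a::{zero,one} mat \<times> 'a mat \<Rightarrow> bool" where
  "canonical_block P \<longleftrightarrow> (\<exists>k\<ge>1. P = (1\<^sub>m k, Jmat k) \<or> P = (Jmat k, 1\<^sub>m k) \<or>
      P = (Lmat k, Rmat k) \<or> P = (transpose_mat (Lmat k), transpose_mat (Rmat k)))"

definition regularizing_decomposition ::
  "'a::field mat \<times> 'a mat \<Rightarrow> 'a mat \<Rightarrow> ('a mat \<times> 'a mat) list \<Rightarrow> bool" where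
  "regularizing_decomposition P D blocks \<longleftrightarrow>
     D \<in> carrier_mat (dim_row D) (dim_row D) \<and> invertible_mat D \<and>
     (\<forall>b \<in> set blocks. canonical_block b) \<and>
     pair_equiv (pair_dsum (1\<^sub>m (dim_row D), D) (pair_dsum_list blocks)) P"

text \<open>Subquotients S/K of a vector space (K \<subseteq> S subspaces) are represented by the pair (S, K).
  qbasis scale S K bs: the classes of bs form a basis of S/K.  With S = UNIV, K = {0}
  this is an ordinary (ordered) basis.\<close>

definition qbasis :: "('f::field \<Rightarrow> 'u::ab_group_add \<Rightarrow> 'u) \<Rightarrow> 'u set \<Rightarrow> 'u set \<Rightarrow> 'u list \<Rightarrow> bool" where
  "qbasis scale S K bs \<longleftrightarrow> set bs \<subseteq> S \<and>
     (\<forall>c. (\<Sum>i<length bs. scale (c i) (bs ! i)) \<in> K \<longrightarrow> (\<forall>i<length bs. c i = 0)) \<and>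
     (\<forall>u\<in>S. \<exists>c. u - (\<Sum>i<length bs. scale (c i) (bs ! i)) \<in> K)"

definition qmat :: "('f::field \<Rightarrow> 'v::ab_group_add \<Rightarrow> 'v) \<Rightarrow> ('u \<Rightarrow> 'v) \<Rightarrow> 'u list \<Rightarrow> 'v list
    \<Rightarrow> 'f mat \<Rightarrow> 'v set \<Rightarrow> bool" where
  "qmat scale f us vs M W \<longleftrightarrow> M \<in> carrier_mat (length vs) (length us) \<and>
     (\<forall>k<length us. f (us ! k) - (\<Sum>i<length vs. scale (M $$ (i, k)) (vs ! i)) \<in> W)"

text \<open>Sequence 1: P_{1j} = (A,B) restricted to U_{1j} \<subseteq> U, V_{1j} \<subseteq> V; index j \<ge> 1.\<close>

definition step1 :: "('u \<Rightarrow> 'v) \<Rightarrow> ('u \<Rightarrow> 'v) \<Rightarrow> 'u set \<times> 'v set \<Rightarrow> 'u set \<times> 'v set" where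
  "step1 A B = (\<lambda>(S, T). ({u \<in> S. A u \<in> B ` S}, B ` S))"

definition P1 :: "('u \<Rightarrow> 'v) \<Rightarrow> ('u \<Rightarrow> 'v) \<Rightarrow> nat \<Rightarrow> 'u set \<times> 'v set" where
  "P1 A B j = (step1 A B ^^ (j - 1)) (UNIV, UNIV)"

definition ell1 :: "('u \<Rightarrow> 'v) \<Rightarrow> ('u \<Rightarrow> 'v) \<Rightarrow> nat" where
  "ell1 A B = (LEAST j. 1 \<le> j \<and> B ` fst (P1 A B j) = snd (P1 A B j))"

definition step2 :: "('u \<Rightarrow> 'v) \<Rightarrow> ('u \<Rightarrow> 'v) \<Rightarrow> 'u set \<times> 'v set \<Rightarrow> 'u set \<times> 'v set" where
  "step2 A B = (\<lambda>(S, T). ({u \<in> S. B u \<in> A ` S}, A ` S))"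

definition P2 :: "('u \<Rightarrow> 'v) \<Rightarrow> ('u \<Rightarrow> 'v) \<Rightarrow> nat \<Rightarrow> 'u set \<times> 'v set" where
  "P2 A B j = (step2 A B ^^ (j - 1)) (P1 A B (ell1 A B))"

definition ell2 :: "('u \<Rightarrow> 'v) \<Rightarrow> ('u \<Rightarrow> 'v) \<Rightarrow> nat" where
  "ell2 A B = (LEAST j. 1 \<le> j \<and> A ` fst (P2 A B j) = snd (P2 A B j))"

text \<open>Sequence 3: starts with P_{31} = P_{2,ell2} = (U', V').  The quotient spaces are
  U_{3j} = U'/K_j and V_{3j} = V'/W_j (K_1 = W_1 = 0).  By the third isomorphism theorem
  U_{3j}/Ker B_{3j} = U'/K_{j+1} with K_{j+1} = {u \<in> U'. B u \<in> W_j} (the preimage of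
  Ker B_{3j}), and V_{3j}/A_{3j}(Ker B_{3j}) = V'/W_{j+1} with W_{j+1} = W_j + A(K_{j+1}).\<close>

definition U3base :: "('u \<Rightarrow> 'v) \<Rightarrow> ('u \<Rightarrow> 'v) \<Rightarrow> 'u set" where
  "U3base A B = fst (P2 A B (ell2 A B))"

definition V3base :: "('u \<Rightarrow> 'v) \<Rightarrow> ('u \<Rightarrow> 'v) \<Rightarrow> 'v set" where
  "V3base A B = snd (P2 A B (ell2 A B))"

definition step3 :: "('u \<Rightarrow> 'v::ab_group_add) \<Rightarrow> ('u \<Rightarrow> 'v) \<Rightarrow> 'u set \<times> 'v set \<Rightarrow> 'u set \<times> 'v set" where
  "step3 A B = (\<lambda>(K, W). let K' = {u \<in> U3base A B. B u \<in> W}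
                         in (K', {w + A x | w x. w \<in> W \<and> x \<in> K'}))"

definition Q3 :: "('u::zero \<Rightarrow> 'v::ab_group_add) \<Rightarrow> ('u \<Rightarrow> 'v) \<Rightarrow> nat \<Rightarrow> 'u set \<times> 'v set" where
  "Q3 A B j = (step3 A B ^^ (j - 1)) ({0}, {0})"

definition quot_bij :: "('u \<Rightarrow> 'v::ab_group_add) \<Rightarrow> 'u set \<Rightarrow> 'u set \<Rightarrow> 'v set \<Rightarrow> 'v set \<Rightarrow> bool" where
  "quot_bij f S K T W \<longleftrightarrow> (\<forall>u\<in>S. f u \<in> W \<longrightarrow> u \<in> K) \<and> (\<forall>v\<in>T. \<exists>u\<in>S. f u - v \<in> W)"

definition ell3 :: "('u::zero \<Rightarrow> 'v::ab_group_add) \<Rightarrow> ('u \<Rightarrow> 'v) \<Rightarrow> nat" where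
  "ell3 A B = (LEAST j. 1 \<le> j \<and>
     quot_bij B (U3base A B) (fst (Q3 A B j)) (V3base A B) (snd (Q3 A B j)))"

definition dU1 :: "('f::field \<Rightarrow> 'u::ab_group_add \<Rightarrow> 'u) \<Rightarrow> ('u \<Rightarrow> 'v) \<Rightarrow> ('u \<Rightarrow> 'v) \<Rightarrow> nat \<Rightarrow> int" where
  "dU1 sU A B j = int (vector_space.dim sU (fst (P1 A B j)))"

definition dV1 :: "('f::field \<Rightarrow> 'v::ab_group_add \<Rightarrow> 'v) \<Rightarrow> ('u \<Rightarrow> 'v) \<Rightarrow> ('u \<Rightarrow> 'v) \<Rightarrow> nat \<Rightarrow> int" where
  "dV1 sV A B j = int (vector_space.dim sV (snd (P1 A B j)))"

definition dV2 :: "('f::field \<Rightarrow> 'v::ab_group_add \<Rightarrow> 'v) \<Rightarrow> ('u \<Rightarrow> 'v) \<Rightarrow> ('u \<Rightarrow> 'v) \<Rightarrow> nat \<Rightarrow> int" where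
  "dV2 sV A B j = int (vector_space.dim sV (snd (P2 A B j)))"

definition dU3 :: "('f::field \<Rightarrow> 'u::ab_group_add \<Rightarrow> 'u) \<Rightarrow> ('u \<Rightarrow> 'v::ab_group_add) \<Rightarrow> ('u \<Rightarrow> 'v) \<Rightarrow> nat \<Rightarrow> int" where
  "dU3 sU A B j = int (vector_space.dim sU (U3base A B)) - int (vector_space.dim sU (fst (Q3 A B j)))"

definition mult_LRT where
  "mult_LRT sU sV A B j = (dV1 sV A B j - dV1 sV A B (j + 1)) - (dU1 sU A B j - dU1 sU A B (j + 1))"

definition mult_IJ where
  "mult_IJ sU sV A B j = (dU1 sU A B j - dU1 sU A B (j + 1)) - (dV1 sV A B (j + 1) - dV1 sV A B (j + 2))"

definition mult_JI where
  "mult_JI sV A B j = dV2 sV A B j - 2 * dV2 sV A B (j + 1) + dV2 sV A B (j + 2)"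

definition mult_LR where
  "mult_LR sU A B j = dU3 sU A B j - 2 * dU3 sU A B (j + 1) + dU3 sU A B (j + 2)"

definition sing_blocks :: "('f::field \<Rightarrow> 'u::ab_group_add \<Rightarrow> 'u) \<Rightarrow> ('f \<Rightarrow> 'v::ab_group_add \<Rightarrow> 'v)
    \<Rightarrow> ('u \<Rightarrow> 'v) \<Rightarrow> ('u \<Rightarrow> 'v) \<Rightarrow> ('f mat \<times> 'f mat) list" where
  "sing_blocks sU sV A B =
     concat (map (\<lambda>j. replicate (nat (mult_LRT sU sV A B j)) (transpose_mat (Lmat j), transpose_mat (Rmat j))) [1..<ell1 A B])
   @ concat (map (\<lambda>j. replicate (nat (mult_IJ sU sV A B j)) (1\<^sub>m j, Jmat j)) [1..<ell1 A B])
   @ concat (map (\<lambda>j. replicate (nat (mult_JI sV A B j)) (Jmat j, 1\<^sub>m j)) [1..<ell2 A B])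
   @ concat (map (\<lambda>j. replicate (nat (mult_LR sU A B j)) (Lmat j, Rmat j)) [1..<ell3 A B])"

end

theory Submission
  imports Defs
begin

text \<open>
  Each reduction step is reversed by lengthening chains. For the first sequence, suppose that
  \<open>(U', V')\<close> with \<open>V' = B U\<close> and \<open>U' = A\<inverse> V'\<close> has been split, modulo the final term of the
  sequence, into chains \<open>f_1 \<mapsto> f_2 \<mapsto> \<dots>\<close> with \<open>A e_i = f_i\<close> and \<open>B e_i = f_(i+1)\<close>. The heads \<open>f_1\<close> form a
  basis of \<open>V'\<close> modulo \<open>B U'\<close>, so preimages \<open>e_0\<close> with \<open>B e_0 = f_1\<close> are independent modulo \<open>U'\<close>
  and can be completed to a basis of \<open>U\<close> modulo \<open>U'\<close> by vectors of \<open>ker B\<close>. Since \<open>A\<close> embeds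
  \<open>U / U'\<close> into \<open>V / V'\<close>, prepending \<open>e_0\<close> and \<open>A e_0\<close> lengthens every chain by one, the kernel vectors
  start new chains of type \<open>(I_1, J_1(0))\<close>, and completing \<open>A e_0\<close> to a basis of \<open>V / V'\<close> gives new
  chains of type \<open>(L_1\<^sup>T, R_1\<^sup>T)\<close>; dimensions count both. The second sequence is the first one with
  \<open>A\<close> and \<open>B\<close> exchanged; there \<open>B\<close> is onto, which excludes the transposed blocks. In the third sequence
  chains modulo \<open>(K', W')\<close> are lifted to chains modulo \<open>(K, W)\<close>: as \<open>B\<close> induces an isomorphism from
  \<open>S / K'\<close> onto \<open>T / W\<close>, the vectors of \<open>T\<close> are redefined through \<open>B\<close>, the vectors of \<open>S\<close> are
  corrected by elements of \<open>K'\<close> to repair the relations for \<open>A\<close>, and each chain gains a first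
  vector in \<open>K'\<close>. The regular part is lifted in the same way without changing \<open>D\<close>.
\<close>

subsection \<open>Bases modulo a subspace\<close>

context finite_dimensional_vector_space
begin

definition lincomb :: "(nat \<Rightarrow> 'a) \<Rightarrow> 'b list \<Rightarrow> 'b" where
  "lincomb c bs = (\<Sum>i<length bs. c i *s bs ! i)"

definition indep_mod :: "'b set \<Rightarrow> 'b list \<Rightarrow> bool" where
  "indep_mod K bs \<longleftrightarrow> (\<forall>c. lincomb c bs \<in> K \<longrightarrow> (\<forall>i<length bs. c i = 0))"

text \<open>By \<open>qbasis_iff_basis_mod\<close> below this is \<^const>\<open>qbasis\<close>; stated through span and dimension it is
  visibly independent of the order of the list.\<close>

definition basis_mod :: "'b set \<Rightarrow> 'b set \<Rightarrow> 'b list \<Rightarrow> bool" where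
  "basis_mod S K bs \<longleftrightarrow> set bs \<subseteq> S \<and> S \<subseteq> span (K \<union> set bs) \<and> dim S = dim K + length bs"

lemma lincomb_Nil [simp]: "lincomb c [] = 0"
  by (simp add: lincomb_def)

lemma lincomb_Cons [simp]: "lincomb c (b # bs) = c 0 *s b + lincomb (\<lambda>i. c (Suc i)) bs"
  by (simp add: lincomb_def sum.lessThan_Suc_shift del: sum.lessThan_Suc)

lemma lincomb_in_span: "lincomb c bs \<in> span (set bs)"
  unfolding lincomb_def by (intro span_sum span_scale span_base) auto

lemma lincomb_in_subspace: "subspace S \<Longrightarrow> set bs \<subseteq> S \<Longrightarrow> lincomb c bs \<in> S"
  using lincomb_in_span span_minimal by blast

lemma span_set_lincomb:
  assumes "x \<in> span (set bs)"
  shows "\<exists>c. x = lincomb c bs"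
  using assms
proof (induction bs arbitrary: x)
  case (Cons b bs)
  then obtain k where "x - k *s b \<in> span (set bs)"
    by (auto simp: span_insert)
  then obtain c where c: "x - k *s b = lincomb c bs"
    using Cons.IH by blast
  have "x = lincomb (\<lambda>i. case i of 0 \<Rightarrow> k | Suc n \<Rightarrow> c n) (b # bs)"
    using c by (simp add: algebra_simps)
  then show ?case by blast
qed auto

lemma span_Un_iff:
  assumes "subspace K"
  shows "x \<in> span (K \<union> Z) \<longleftrightarrow> (\<exists>z\<in>span Z. x - z \<in> K)"
proof -
  have "x \<in> span (K \<union> Z) \<longleftrightarrow> (\<exists>k\<in>K. \<exists>z\<in>span Z. x = k + z)"
    using assms by (auto simp: span_Un span_eq_iff[THEN iffD2])
  also have "\<dots> \<longleftrightarrow> (\<exists>z\<in>span Z. x - z \<in> K)"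
    by (metis add_diff_cancel_right' diff_add_cancel)
  finally show ?thesis .
qed

lemma span_Un_lincomb_iff:
  assumes "subspace K"
  shows "x \<in> span (K \<union> set bs) \<longleftrightarrow> (\<exists>c. x - lincomb c bs \<in> K)"
  unfolding span_Un_iff[OF assms] using span_set_lincomb lincomb_in_span by metis

lemma span_Un_mono: "K \<subseteq> span K' \<Longrightarrow> Z \<subseteq> span Z' \<Longrightarrow> span (K \<union> Z) \<subseteq> span (K' \<union> Z')"
  by (rule span_minimal) (meson Un_upper1 Un_upper2 Un_least dual_order.trans span_mono, simp)

lemma dim_Un_list_le: "dim (K \<union> set bs) \<le> dim K + length bs"
proof (induction bs)
  case (Cons b bs)
  then show ?case by (auto simp: dim_insert)
qed auto

text \<open>Solving a relation for the head turns dependence into membership of \<open>b\<close> in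
  a span; in this form \<open>dim_insert\<close> counts independence one vector at a time.\<close>

lemma indep_mod_Cons:
  assumes "subspace K"
  shows "indep_mod K (b # bs) \<longleftrightarrow> indep_mod K bs \<and> b \<notin> span (K \<union> set bs)"
proof (intro iffI conjI)
  assume ind: "indep_mod K (b # bs)"
  show "indep_mod K bs"
    unfolding indep_mod_def
  proof (intro allI impI)
    fix c i assume "lincomb c bs \<in> K" "i < length bs"
    moreover from this have "lincomb (\<lambda>i. case i of 0 \<Rightarrow> 0 | Suc n \<Rightarrow> c n) (b # bs) \<in> K"
      by simp
    ultimately have "(case Suc i of 0 \<Rightarrow> 0 | Suc n \<Rightarrow> c n) = 0"
      using ind unfolding indep_mod_def by (metis Suc_less_eq length_Cons)
    then show "c i = 0" by simp
  qed
  show "b \<notin> span (K \<union> set bs)"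
  proof
    assume "b \<in> span (K \<union> set bs)"
    then obtain c where c: "b - lincomb c bs \<in> K"
      using span_Un_lincomb_iff[OF assms] by blast
    have "lincomb (\<lambda>i. case i of 0 \<Rightarrow> 1 | Suc n \<Rightarrow> - c n) (b # bs) = b - lincomb c bs"
      unfolding lincomb_Cons by (simp add: lincomb_def sum_negf)
    then have "(case 0 of 0 \<Rightarrow> 1 | Suc n \<Rightarrow> - c n) = 0"
      using ind c unfolding indep_mod_def by (metis length_Cons zero_less_Suc)
    then show False by simp
  qed
next
  assume r: "indep_mod K bs \<and> b \<notin> span (K \<union> set bs)"
  show "indep_mod K (b # bs)"
    unfolding indep_mod_def
  proof (intro allI impI)
    fix c i assume *: "lincomb c (b # bs) \<in> K" "i < length (b # bs)"
    have "c 0 *s b \<in> span (K \<union> set bs)"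
    proof -
      have "c 0 *s b - lincomb (\<lambda>i. - c (Suc i)) bs \<in> K"
        using *(1) unfolding lincomb_Cons by (simp add: lincomb_def sum_negf)
      then show ?thesis using span_Un_lincomb_iff[OF assms] by blast
    qed
    then have 0: "c 0 = 0"
      using r span_scale[of "c 0 *s b" _ "inverse (c 0)"] by (cases "c 0 = 0") auto
    then have "lincomb (\<lambda>i. c (Suc i)) bs \<in> K" using * by simp
    then have "\<forall>i<length bs. c (Suc i) = 0" using r unfolding indep_mod_def by blast
    then show "c i = 0" using 0 * by (cases i) auto
  qed
qed

text \<open>Each vector raises the dimension by at most one, so the full count is reached exactly
  when no vector lies in the span of \<open>K\<close> and the vectors after it.\<close>

lemma indep_mod_iff_dim:
  assumes "subspace K"
  shows "indep_mod K bs \<longleftrightarrow> dim (K \<union> set bs) = dim K + length bs"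
proof (induction bs)
  case Nil then show ?case by (simp add: indep_mod_def)
next
  case (Cons b bs)
  have "dim (K \<union> set (b # bs)) = (if b \<in> span (K \<union> set bs) then dim (K \<union> set bs) else dim (K \<union> set bs) + 1)"
    by (simp add: dim_insert)
  then show ?case
    using Cons dim_Un_list_le[of K bs] indep_mod_Cons[OF assms, of b bs] by auto
qed

lemma basis_mod_iff_indep:
  assumes "subspace S" "subspace K" "K \<subseteq> S"
  shows "basis_mod S K bs \<longleftrightarrow> set bs \<subseteq> S \<and> S \<subseteq> span (K \<union> set bs) \<and> indep_mod K bs"
proof -
  have "dim S = dim (K \<union> set bs)" if "set bs \<subseteq> S" "S \<subseteq> span (K \<union> set bs)"
  proof (rule antisym)
    show "dim S \<le> dim (K \<union> set bs)" using that dim_mono by blast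
    show "dim (K \<union> set bs) \<le> dim S" using that assms by (intro dim_subset) auto
  qed
  then show ?thesis
    unfolding basis_mod_def indep_mod_iff_dim[OF assms(2)] by metis
qed

lemma qbasis_iff_basis_mod:
  assumes "subspace S" "subspace K" "K \<subseteq> S"
  shows "qbasis scale S K bs \<longleftrightarrow> basis_mod S K bs"
proof -
  have "S \<subseteq> span (K \<union> set bs) \<longleftrightarrow> (\<forall>u\<in>S. \<exists>c. u - lincomb c bs \<in> K)"
    using span_Un_lincomb_iff[OF assms(2)] by blast
  then show ?thesis
    unfolding basis_mod_iff_indep[OF assms] qbasis_def indep_mod_def lincomb_def[symmetric] by blast
qed

lemma basis_mod_self: "basis_mod S S []"
  by (auto simp: basis_mod_def span_base)

lemma basis_mod_trans:
  assumes "basis_mod S K bs" "basis_mod K L cs" "K \<subseteq> S"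
  shows "basis_mod S L (bs @ cs)"
proof -
  have "S \<subseteq> span (K \<union> set bs)" using assms(1) by (simp add: basis_mod_def)
  also have "\<dots> \<subseteq> span ((L \<union> set cs) \<union> set bs)"
    using assms(2) by (intro span_Un_mono) (auto simp: basis_mod_def span_base)
  finally show ?thesis using assms by (auto simp: basis_mod_def Un_ac)
qed

lemma basis_mod_permute:
  assumes "basis_mod S K bs" "set bs' = set bs" "length bs' = length bs"
  shows "basis_mod S K bs'"
  using assms by (simp add: basis_mod_def)

lemma basis_mod_span: "subspace K \<Longrightarrow> indep_mod K bs \<Longrightarrow> basis_mod (span (K \<union> set bs)) K bs"
  by (auto simp: basis_mod_def indep_mod_iff_dim span_base)

text \<open>With M the span of \<open>K \<union> set cs\<close>, the bounds \<open>dim S\<close>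
  \<le> dim M + \<open>length bs\<close> and dim M \<le> \<open>dim K + length cs\<close> add up to
  an equality, so both are sharp.\<close>

lemma basis_mod_split:
  assumes "basis_mod S K (bs @ cs)" "subspace S" "subspace K" "K \<subseteq> S"
  shows "basis_mod S (span (K \<union> set cs)) bs" "basis_mod (span (K \<union> set cs)) K cs"
    "span (K \<union> set cs) \<subseteq> S"
proof -
  let ?M = "span (K \<union> set cs)"
  have "S \<subseteq> span (K \<union> set (bs @ cs))" using assms by (simp add: basis_mod_def)
  also have "\<dots> \<subseteq> span (?M \<union> set bs)"
    by (rule span_minimal) (auto intro: span_base)
  finally have sp: "S \<subseteq> span (?M \<union> set bs)" .
  have "dim S \<le> dim ?M + length bs"
    using dim_mono[OF sp] dim_Un_list_le[of ?M bs] by simp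
  moreover have "dim ?M \<le> dim K + length cs" using dim_Un_list_le by simp
  moreover have "dim S = dim K + length bs + length cs"
    using assms by (simp add: basis_mod_def)
  ultimately have "dim S = dim ?M + length bs" "dim ?M = dim K + length cs" by auto
  moreover have "?M \<subseteq> S"
    using assms by (intro span_minimal) (auto simp: basis_mod_def)
  ultimately show "basis_mod S ?M bs" "basis_mod ?M K cs" "?M \<subseteq> S"
    using assms(1) sp by (auto simp: basis_mod_def intro: span_base)
qed

text \<open>Induction on the codimension of \<open>K\<close>: vectors of \<open>Z\<close> outside
  \<open>K\<close> are adjoined until \<open>K\<close> contains \<open>Z\<close>. Drawing them from
  \<open>Z\<close> matters where \<open>Z\<close> is the kernel of one of the maps, possibly modulo
  a subspace.\<close>

lemma basis_mod_extend:
  assumes "subspace S" "subspace K" "K \<subseteq> S" "Z \<subseteq> S" "S \<subseteq> span (K \<union> Z)"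
  shows "\<exists>N. set N \<subseteq> Z \<and> basis_mod S K N"
  using assms
proof (induction "dim S - dim K" arbitrary: K rule: less_induct)
  case less
  show ?case
  proof (cases "Z \<subseteq> K")
    case True
    then have "S \<subseteq> K" using less.prems by (metis Un_absorb2 span_eq_iff)
    then show ?thesis using less.prems basis_mod_self by (intro exI[of _ "[]"]) auto
  next
    case False
    then obtain z where z: "z \<in> Z" "z \<notin> K" by blast
    let ?K = "span (insert z K)"
    have sub: "?K \<subseteq> S" using z less.prems by (intro span_minimal) auto
    have d: "dim ?K = dim K + 1"
      using z less.prems(2) by (simp add: dim_insert span_eq_iff[THEN iffD2])
    have "dim ?K \<le> dim S" using sub by (rule dim_subset)
    then have "dim S - dim ?K < dim S - dim K" using d by simp
    moreover have "S \<subseteq> span (?K \<union> Z)"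
    proof -
      have "K \<union> Z \<subseteq> span (?K \<union> Z)" by (auto intro!: span_base)
      then have "span (K \<union> Z) \<subseteq> span (?K \<union> Z)" by (rule span_minimal) simp
      then show ?thesis using less.prems(5) by blast
    qed
    ultimately obtain N where N: "set N \<subseteq> Z" "basis_mod S ?K N"
      using less.hyps[of ?K] sub less.prems by auto
    have "S \<subseteq> span (?K \<union> set N)" using N by (simp add: basis_mod_def)
    also have "\<dots> \<subseteq> span (K \<union> set (z # N))"
      by (rule span_minimal) (auto intro: span_base span_mono[THEN subsetD, rotated])
    finally have "basis_mod S K (z # N)"
      using N d z less.prems by (auto simp: basis_mod_def)
    then show ?thesis using N z by (intro exI[of _ "z # N"]) auto
  qed
qed

lemma indep_mod_extend:
  assumes "subspace S" "subspace K" "K \<subseteq> S" "set bs \<subseteq> S" "indep_mod K bs"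
    and "Z \<subseteq> S" "S \<subseteq> span (K \<union> set bs \<union> Z)"
  shows "\<exists>N. set N \<subseteq> Z \<and> basis_mod S K (bs @ N)"
proof -
  let ?M = "span (K \<union> set bs)"
  have M: "?M \<subseteq> S" using assms by (intro span_minimal) auto
  have "S \<subseteq> span (?M \<union> Z)"
  proof -
    have "K \<union> set bs \<union> Z \<subseteq> span (?M \<union> Z)" by (auto intro!: span_base)
    then have "span (K \<union> set bs \<union> Z) \<subseteq> span (?M \<union> Z)" by (rule span_minimal) simp
    then show ?thesis using assms(7) by blast
  qed
  then obtain N where N: "set N \<subseteq> Z" "basis_mod S ?M N"
    using basis_mod_extend[OF assms(1) subspace_span M assms(6)] by blast
  have "basis_mod S K (N @ bs)"
    using basis_mod_trans[OF N(2) basis_mod_span M] assms by blast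
  then have "basis_mod S K (bs @ N)" by (rule basis_mod_permute) auto
  then show ?thesis using N by blast
qed

text \<open>Corrections from \<open>K\<close> change neither the span taken together with
  \<open>K\<close> nor the length of the list.\<close>

lemma basis_mod_perturb:
  assumes "basis_mod S K bs" "list_all2 (\<lambda>b' b. b' - b \<in> K) bs' bs"
    and "subspace S" "subspace K" "K \<subseteq> S"
  shows "basis_mod S K bs'"
proof -
  have len: "length bs' = length bs" and diff: "\<And>i. i < length bs \<Longrightarrow> bs' ! i - bs ! i \<in> K"
    using assms(2) by (auto simp: list_all2_conv_all_nth)
  have "bs' ! i \<in> S" if "i < length bs" for i
  proof -
    have "bs ! i \<in> S" using assms(1) that by (auto simp: basis_mod_def)
    moreover have "bs' ! i - bs ! i \<in> S" using assms(5) diff that by auto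
    ultimately have "(bs' ! i - bs ! i) + bs ! i \<in> S" using assms(3) subspace_add by blast
    then show ?thesis by simp
  qed
  then have 1: "set bs' \<subseteq> S" using len by (auto simp: in_set_conv_nth)
  have "bs ! i \<in> span (K \<union> set bs')" if "i < length bs" for i
  proof -
    have "bs' ! i - (bs' ! i - bs ! i) \<in> span (K \<union> set bs')"
      using that len diff by (intro span_diff span_base) auto
    then show ?thesis by simp
  qed
  then have "K \<union> set bs \<subseteq> span (K \<union> set bs')"
    by (auto simp: in_set_conv_nth span_base)
  then have "span (K \<union> set bs) \<subseteq> span (K \<union> set bs')"
    by (metis span_minimal subspace_span)
  then show ?thesis using 1 len assms(1) by (auto simp: basis_mod_def)
qed

section \<open>Matrices of linear maps modulo a subspace\<close>

lemma lincomb_cong: "(\<And>i. i < length bs \<Longrightarrow> c i = d i) \<Longrightarrow> lincomb c bs = lincomb d bs"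
  unfolding lincomb_def by (rule sum.cong) auto

lemma lincomb_append: "lincomb c (xs @ ys) = lincomb c xs + lincomb (\<lambda>i. c (i + length xs)) ys"
  by (induction xs arbitrary: c) (simp_all add: add.assoc)

lemma lincomb_zero: "(\<And>i. i < length bs \<Longrightarrow> c i = 0) \<Longrightarrow> lincomb c bs = 0"
  unfolding lincomb_def by (rule sum.neutral) auto

lemma lincomb_delta:
  assumes "\<And>i. i < length bs \<Longrightarrow> c i = (if i = m then 1 else 0)"
  shows "lincomb c bs = (if m < length bs then bs ! m else 0)"
proof -
  have "lincomb c bs = (\<Sum>i<length bs. if i = m then bs ! i else 0)"
    unfolding lincomb_def using assms by (intro sum.cong) auto
  then show ?thesis by (simp add: sum.delta)
qed

lemma lincomb_diff: "lincomb (\<lambda>i. c i - d i) bs = lincomb c bs - lincomb d bs"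
  by (simp add: lincomb_def scale_left_diff_distrib sum_subtractf)

lemma lincomb_nested:
  "lincomb c (map (\<lambda>j. lincomb (\<lambda>i. N i j) ws) [0..<n]) = lincomb (\<lambda>i. \<Sum>j<n. N i j * c j) ws"
proof -
  have "lincomb c (map (\<lambda>j. lincomb (\<lambda>i. N i j) ws) [0..<n])
      = (\<Sum>j<n. \<Sum>i<length ws. (N i j * c j) *s ws ! i)"
    by (simp add: lincomb_def scale_sum_right mult.commute)
  also have "\<dots> = (\<Sum>i<length ws. \<Sum>j<n. (N i j * c j) *s ws ! i)" by (rule sum.swap)
  also have "\<dots> = lincomb (\<lambda>i. \<Sum>j<n. N i j * c j) ws"
    by (simp add: lincomb_def scale_sum_left)
  finally show ?thesis .
qed

lemma qmat_iff:
  "qmat scale f us vs M W \<longleftrightarrow> M \<in> carrier_mat (length vs) (length us) \<and>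
     (\<forall>k<length us. f (us ! k) - lincomb (\<lambda>i. M $$ (i, k)) vs \<in> W)"
  by (simp add: qmat_def lincomb_def)

lemma qmat_exists:
  assumes "basis_mod T W vs" "subspace W" "\<And>u. u \<in> set us \<Longrightarrow> f u \<in> T"
  shows "\<exists>M. qmat scale f us vs M W"
proof -
  have "\<exists>c. f (us ! k) - lincomb c vs \<in> W" if "k < length us" for k
  proof -
    have "f (us ! k) \<in> span (W \<union> set vs)"
      using assms that by (auto simp: basis_mod_def)
    then show ?thesis using span_Un_lincomb_iff[OF assms(2)] by blast
  qed
  then obtain c where c: "\<And>k. k < length us \<Longrightarrow> f (us ! k) - lincomb (c k) vs \<in> W" by metis
  have "lincomb (\<lambda>i. mat (length vs) (length us) (\<lambda>(i, k). c k i) $$ (i, k)) vs = lincomb (c k) vs"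
    if "k < length us" for k
    using that by (intro lincomb_cong) auto
  then have "qmat scale f us vs (mat (length vs) (length us) (\<lambda>(i, k). c k i)) W"
    using c by (simp add: qmat_iff)
  then show ?thesis by blast
qed

text \<open>The difference of two corresponding columns gives a combination of \<open>vs\<close>
  lying in \<open>W\<close>, so it vanishes by independence modulo \<open>W\<close>.\<close>

lemma qmat_unique:
  assumes "basis_mod T W vs" "subspace T" "subspace W" "W \<subseteq> T"
    and "qmat scale f us vs M W" "qmat scale f us vs M' W"
  shows "M = M'"
proof (rule eq_matI)
  fix i k assume ik: "i < dim_row M'" "k < dim_col M'"
  let ?c = "\<lambda>i. M $$ (i, k) - M' $$ (i, k)"
  have k: "k < length us" "i < length vs" using ik assms(6) by (auto simp: qmat_iff)
  then have "(f (us ! k) - lincomb (\<lambda>i. M' $$ (i, k)) vs) - (f (us ! k) - lincomb (\<lambda>i. M $$ (i, k)) vs) \<in> W"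
    using assms subspace_diff[OF assms(3)] unfolding qmat_iff by blast
  then have "lincomb ?c vs \<in> W" by (simp add: lincomb_diff)
  then have "?c i = 0"
    using basis_mod_iff_indep[OF assms(2-4)] assms(1) k unfolding indep_mod_def by metis
  then show "M $$ (i, k) = M' $$ (i, k)" by simp
qed (use assms in \<open>auto simp: qmat_iff\<close>)

lemma qmat_one:
  assumes "length us = length vs"
  shows "qmat scale f us vs (1\<^sub>m (length vs)) W \<longleftrightarrow> (\<forall>k<length us. f (us ! k) - vs ! k \<in> W)"
proof -
  have "lincomb (\<lambda>i. 1\<^sub>m (length vs) $$ (i, k)) vs = vs ! k" if "k < length us" for k
    using that assms by (subst lincomb_delta[of _ _ k]) auto
  then show ?thesis using assms by (simp add: qmat_iff)
qed

lemma qmat_append: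
  assumes "qmat scale f us vs M {0}" "qmat scale f us' vs' M' {0}"
  shows "qmat scale f (us @ us') (vs @ vs')
    (four_block_mat M (0\<^sub>m (dim_row M) (dim_col M')) (0\<^sub>m (dim_row M') (dim_col M)) M') {0}"
    (is "qmat scale f _ _ ?M _")
proof -
  have M: "dim_row M = length vs" "dim_col M = length us" "dim_row M' = length vs'" "dim_col M' = length us'"
    using assms by (auto simp: qmat_iff)
  have "f ((us @ us') ! k) = lincomb (\<lambda>i. ?M $$ (i, k)) (vs @ vs')" if "k < length (us @ us')" for k
  proof (cases "k < length us")
    case True
    have "lincomb (\<lambda>i. ?M $$ (i, k)) vs = lincomb (\<lambda>i. M $$ (i, k)) vs"
      using True M by (intro lincomb_cong) auto
    moreover have "lincomb (\<lambda>i. ?M $$ (i + length vs, k)) vs' = 0"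
      using True M by (intro lincomb_zero) auto
    moreover have "f (us ! k) = lincomb (\<lambda>i. M $$ (i, k)) vs"
      using assms(1) True by (simp add: qmat_iff)
    ultimately show ?thesis using True by (simp add: lincomb_append nth_append)
  next
    case False
    have "lincomb (\<lambda>i. ?M $$ (i + length vs, k)) vs' = lincomb (\<lambda>i. M' $$ (i, k - length us)) vs'"
      using False that M by (intro lincomb_cong) auto
    moreover have "lincomb (\<lambda>i. ?M $$ (i, k)) vs = 0"
      using False that M by (intro lincomb_zero) auto
    moreover have "f (us' ! (k - length us)) = lincomb (\<lambda>i. M' $$ (i, k - length us)) vs'"
      using assms(2) False that by (simp add: qmat_iff)
    ultimately show ?thesis using False by (simp add: lincomb_append nth_append)
  qed
  moreover have "?M \<in> carrier_mat (length (vs @ vs')) (length (us @ us'))"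
    using M by (intro carrier_matI) simp_all
  ultimately show ?thesis unfolding qmat_iff by simp
qed

section \<open>Matrices of the canonical blocks and of assembled pairs\<close>

lemma qmat_Jmat:
  assumes "length us = length vs" "\<And>i. i < length us \<Longrightarrow> f (us ! i) = (vs @ [0]) ! Suc i"
  shows "qmat scale f us vs (Jmat (length vs)) {0}"
proof -
  \<comment> \<open>In the last column \<open>Suc k\<close> lies outside the matrix, so
    \<open>lincomb_delta\<close> returns 0, the value of the padding.\<close>
  have "lincomb (\<lambda>i. Jmat (length vs) $$ (i, k)) vs = (vs @ [0]) ! Suc k" if "k < length us" for k
    using that assms(1) by (subst lincomb_delta[of _ _ "Suc k"]) (auto simp: Jmat_def nth_append)
  then show ?thesis using assms by (simp add: qmat_iff) (simp add: Jmat_def)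
qed

text \<open>The last column of \<open>Lmat\<close> is zero, whence the padding at the end; for
  \<open>Rmat\<close> it is the first column, whence the padding in front.\<close>

lemma qmat_Lmat:
  assumes "length us = Suc (length vs)" "\<And>i. i < length us \<Longrightarrow> f (us ! i) = (vs @ [0]) ! i"
  shows "qmat scale f us vs (Lmat (length us)) {0}"
proof -
  have "lincomb (\<lambda>i. Lmat (length us) $$ (i, k)) vs = (vs @ [0]) ! k" if "k < length us" for k
    using that assms(1) by (subst lincomb_delta[of _ _ k]) (auto simp: Lmat_def nth_append)
  then show ?thesis using assms by (simp add: qmat_iff) (simp add: Lmat_def)
qed

lemma qmat_Rmat:
  assumes "length us = Suc (length vs)" "\<And>i. i < length us \<Longrightarrow> f (us ! i) = (0 # vs) ! i"
  shows "qmat scale f us vs (Rmat (length us)) {0}"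
proof -
  have "lincomb (\<lambda>i. Rmat (length us) $$ (i, k)) vs = (0 # vs) ! k" if "k < length us" for k
  proof (cases k)
    case 0
    then show ?thesis using that assms(1) by (subst lincomb_zero) (auto simp: Rmat_def)
  next
    case (Suc n)
    then show ?thesis using that assms(1) by (subst lincomb_delta[of _ _ n]) (auto simp: Rmat_def)
  qed
  then show ?thesis using assms by (simp add: qmat_iff) (simp add: Rmat_def)
qed

lemma qmat_transpose_Lmat:
  assumes "length vs = Suc (length us)" "\<And>i. i < length us \<Longrightarrow> f (us ! i) = vs ! i"
  shows "qmat scale f us vs (transpose_mat (Lmat (length vs))) {0}"
proof -
  have "lincomb (\<lambda>i. transpose_mat (Lmat (length vs)) $$ (i, k)) vs = vs ! k" if "k < length us" for k
    using that assms(1) by (subst lincomb_delta[of _ _ k]) (auto simp: Lmat_def)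
  then show ?thesis using assms by (simp add: qmat_iff) (simp add: Lmat_def)
qed

lemma qmat_transpose_Rmat:
  assumes "length vs = Suc (length us)" "\<And>i. i < length us \<Longrightarrow> f (us ! i) = vs ! Suc i"
  shows "qmat scale f us vs (transpose_mat (Rmat (length vs))) {0}"
proof -
  have "lincomb (\<lambda>i. transpose_mat (Rmat (length vs)) $$ (i, k)) vs = vs ! Suc k" if "k < length us" for k
    using that assms(1) by (subst lincomb_delta[of _ _ "Suc k"]) (auto simp: Rmat_def)
  then show ?thesis using assms by (simp add: qmat_iff) (simp add: Rmat_def)
qed

definition gives_pair :: "('c \<Rightarrow> 'b) \<Rightarrow> ('c \<Rightarrow> 'b) \<Rightarrow> 'c list \<Rightarrow> 'b list \<Rightarrow> 'a mat \<times> 'a mat \<Rightarrow> bool" where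
  "gives_pair f g us vs P \<longleftrightarrow> qmat scale f us vs (fst P) {0} \<and> qmat scale g us vs (snd P) {0}"

lemma gives_pair_dsum:
  assumes "gives_pair f g us vs P" "gives_pair f g us' vs' Q"
  shows "gives_pair f g (us @ us') (vs @ vs') (pair_dsum P Q)"
  using assms qmat_append unfolding gives_pair_def pair_dsum_def
  by (auto split: prod.splits)

lemma gives_pair_dsum_list:
  assumes "list_all2 (\<lambda>c P. gives_pair f g (fst c) (snd c) P) cs Ps"
  shows "gives_pair f g (concat (map fst cs)) (concat (map snd cs)) (pair_dsum_list Ps)"
  using assms
proof (induction rule: list_all2_induct)
  case Nil
  then show ?case by (simp add: gives_pair_def pair_dsum_list_def qmat_iff)
next
  case (Cons c cs P Ps)
  then have "gives_pair f g (fst c @ concat (map fst cs)) (snd c @ concat (map snd cs))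
      (pair_dsum P (pair_dsum_list Ps))"
    by (intro gives_pair_dsum) auto
  then show ?case by (simp add: pair_dsum_list_def)
qed

end

section \<open>Transport along linear maps and change of basis\<close>

context finite_dimensional_vector_space_pair
begin

lemma lincomb_map:
  assumes "Vector_Spaces.linear s1 s2 f"
  shows "vs2.lincomb c (map f bs) = f (vs1.lincomb c bs)"
proof -
  interpret Vector_Spaces.linear s1 s2 f by fact
  show ?thesis by (simp add: vs1.lincomb_def vs2.lincomb_def sum scale)
qed

lemma indep_mod_of_map:
  assumes "Vector_Spaces.linear s1 s2 f" "vs2.indep_mod W (map f bs)" "f ` K \<subseteq> W"
  shows "vs1.indep_mod K bs"
  using assms(2,3) unfolding vs1.indep_mod_def vs2.indep_mod_def lincomb_map[OF assms(1)]
  by (auto simp: image_subset_iff)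

text \<open>A relation among the images modulo \<open>W\<close> pulls back to one modulo
  \<open>K\<close>, since on the span \<open>f\<close> sends only elements of \<open>K\<close> into
  \<open>W\<close>.\<close>

lemma indep_mod_map:
  assumes "Vector_Spaces.linear s1 s2 f" "vs1.indep_mod K bs"
    and "\<And>x. x \<in> vs1.span (set bs) \<Longrightarrow> f x \<in> W \<Longrightarrow> x \<in> K"
  shows "vs2.indep_mod W (map f bs)"
  using assms(2,3) vs1.lincomb_in_span
  unfolding vs1.indep_mod_def vs2.indep_mod_def lincomb_map[OF assms(1)] by auto

text \<open>Two errors occur: that of \<open>M\<close> lies in \<open>K\<close> and is carried into
  \<open>W\<close> by \<open>f\<close>; those of \<open>N\<close> are combined with the entries of a
  column of \<open>M\<close> and stay in \<open>W\<close>.\<close>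

lemma qmat_compose:
  assumes "Vector_Spaces.linear s1 s2 f" "vs2.subspace W" "f ` K \<subseteq> W"
    and "qmat s1 g us vs M K" "qmat s2 f vs ws N W"
  shows "qmat s2 (\<lambda>x. f (g x)) us ws (N * M) W"
proof -
  interpret f: Vector_Spaces.linear s1 s2 f by fact
  have M: "M \<in> carrier_mat (length vs) (length us)" and N: "N \<in> carrier_mat (length ws) (length vs)"
    using assms by (auto simp: qmat_def)
  have "f (g (us ! k)) - vs2.lincomb (\<lambda>i. (N * M) $$ (i, k)) ws \<in> W" if k: "k < length us" for k
  proof -
    let ?c = "\<lambda>j. M $$ (j, k)" and ?L = "\<lambda>j. vs2.lincomb (\<lambda>i. N $$ (i, j)) ws"
    have "f (g (us ! k) - vs1.lincomb ?c vs) \<in> W"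
      using assms k by (auto simp: vs1.qmat_iff)
    then have 1: "f (g (us ! k)) - vs2.lincomb ?c (map f vs) \<in> W"
      by (simp add: lincomb_map[OF assms(1)] f.diff)
    have "vs2.lincomb ?c (map f vs) - vs2.lincomb ?c (map ?L [0..<length vs])
      = (\<Sum>j<length vs. s2 (?c j) (f (vs ! j) - ?L j))"
      by (simp add: vs2.lincomb_def vs2.scale_right_diff_distrib sum_subtractf)
    moreover have "\<dots> \<in> W"
      using assms by (intro vs2.subspace_sum vs2.subspace_scale) (auto simp: vs2.qmat_iff)
    moreover have "vs2.lincomb ?c (map ?L [0..<length vs]) = vs2.lincomb (\<lambda>i. (N * M) $$ (i, k)) ws"
      unfolding vs2.lincomb_nested
      using M N k by (intro vs2.lincomb_cong) (auto simp: scalar_prod_def lessThan_atLeast0)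
    ultimately have 2: "vs2.lincomb ?c (map f vs) - vs2.lincomb (\<lambda>i. (N * M) $$ (i, k)) ws \<in> W"
      by simp
    show ?thesis using vs2.subspace_add[OF assms(2) 1 2] by simp
  qed
  then show ?thesis using M N by (simp add: vs2.qmat_iff carrier_matD)
qed

end

context finite_dimensional_vector_space
begin

lemma qmat_compose_id:
  assumes "subspace W" "qmat scale g us vs M W" "qmat scale (\<lambda>x. x) vs ws N W"
  shows "qmat scale g us ws (N * M) W"
proof -
  interpret finite_dimensional_vector_space_pair scale Basis scale Basis by unfold_locales
  show ?thesis
    using qmat_compose[OF linear_ident assms(1) _ assms(2,3)] by simp
qed

text \<open>Expanding either basis in the other gives \<open>M\<close> and \<open>N\<close>; both
  products represent the identity in a single basis and are identity matrices by uniqueness. Equal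
  lengths make \<open>M\<close> square.\<close>

lemma change_of_basis:
  assumes "basis_mod S K bs" "basis_mod S K cs" "subspace S" "subspace K" "K \<subseteq> S"
  shows "\<exists>M. qmat scale (\<lambda>x. x) bs cs M K \<and> invertible_mat M"
proof -
  have sub: "\<And>u. u \<in> set bs \<Longrightarrow> u \<in> S" "\<And>u. u \<in> set cs \<Longrightarrow> u \<in> S"
    and len: "length bs = length cs"
    using assms by (auto simp: basis_mod_def)
  obtain M N where MN: "qmat scale (\<lambda>x. x) bs cs M K" "qmat scale (\<lambda>x. x) cs bs N K"
    using qmat_exists[OF assms(2,4), of bs "\<lambda>x. x"] qmat_exists[OF assms(1,4), of cs "\<lambda>x. x"] sub by blast
  have one: "qmat scale (\<lambda>x. x) ds ds (1\<^sub>m (length ds)) K" for ds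
    using qmat_one[of ds ds "\<lambda>x. x"] subspace_0[OF assms(4)] by simp
  have "M * N = 1\<^sub>m (length cs)" "N * M = 1\<^sub>m (length bs)"
    using qmat_unique[OF _ assms(3-5) _ one] assms(1,2) qmat_compose_id[OF assms(4)] MN by blast+
  then have "invertible_mat M"
    using MN len unfolding invertible_mat_def inverts_mat_def
    by (intro conjI exI[of _ N]) (auto simp: qmat_iff)
  then show ?thesis using MN by blast
qed

end

subsection \<open>Chains of the image filtration\<close>

definition block_sizes :: "(nat \<Rightarrow> nat) \<Rightarrow> nat \<Rightarrow> nat list" where
  "block_sizes c l = concat (map (\<lambda>j. replicate (c j) (Suc j)) [0..<l])"

lemma block_sizes_0 [simp]: "block_sizes c 0 = []"
  by (simp add: block_sizes_def)

text \<open>This recursion mirrors the undoing of one reduction step: every chain already present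
  grows by one, and \<open>c 0\<close> chains of length one are added.\<close>

lemma block_sizes_Suc:
  "block_sizes c (Suc l) = replicate (c 0) 1 @ map Suc (block_sizes (\<lambda>j. c (Suc j)) l)"
proof -
  have "[0..<Suc l] = 0 # map Suc [0..<l]"
    by (simp add: upt_conv_Cons map_Suc_upt del: upt_Suc)
  then show ?thesis
    by (simp add: block_sizes_def map_concat o_def del: upt_Suc)
qed

lemma concat_replicate_block_sizes:
  assumes "1 \<le> l"
  shows "concat (map (\<lambda>j. replicate (c j) (b j)) [1..<l]) = map b (block_sizes (\<lambda>n. c (Suc n)) (l - 1))"
proof -
  have "[1..<l] = map Suc [0..<l - 1]" using assms by (simp add: map_Suc_upt)
  then show ?thesis by (simp add: block_sizes_def map_concat o_def)
qed

lemma block_sizes_eq_Nil: "(\<And>n. c n = 0) \<Longrightarrow> block_sizes c l = []"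
  by (simp add: block_sizes_def)

locale linear_pencil = finite_dimensional_vector_space_pair sU BU sV BV
  for sU :: "'f::field \<Rightarrow> 'u::ab_group_add \<Rightarrow> 'u" and BU
    and sV :: "'f \<Rightarrow> 'v::ab_group_add \<Rightarrow> 'v" and BV +
  fixes A B :: "'u \<Rightarrow> 'v"
  assumes linear_A: "Vector_Spaces.linear sU sV A"
    and linear_B: "Vector_Spaces.linear sU sV B"
begin

sublocale A: Vector_Spaces.linear sU sV A by (rule linear_A)
sublocale B: Vector_Spaces.linear sU sV B by (rule linear_B)

text \<open>A chain with as many vectors in \<open>U\<close> as in \<open>V\<close> gives \<open>(I_k, J_k(0))\<close>; one with a vector less in
  \<open>U\<close> gives \<open>(L_k\<^sup>T, R_k\<^sup>T)\<close>.\<close>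

definition image_chain :: "'u list \<times> 'v list \<Rightarrow> bool" where
  "image_chain c \<longleftrightarrow> snd c \<noteq> [] \<and> length (snd c) \<le> Suc (length (fst c)) \<and> length (fst c) \<le> length (snd c) \<and>
     (\<forall>i<length (fst c). A (fst c ! i) = snd c ! i \<and> B (fst c ! i) = (snd c @ [0]) ! Suc i)"

text \<open>The 0 comes from square chains, whose last vector is killed by \<open>B\<close>. With
  \<open>image_chain_tl_subset\<close> this shows that the image under \<open>B\<close> of the span
  of the \<open>U\<close> parts is the span of the tails of the \<open>V\<close> parts.\<close>

lemma image_chain_B_subset:
  assumes "image_chain c"
  shows "B ` set (fst c) \<subseteq> insert 0 (set (tl (snd c)))"
proof
  fix y assume "y \<in> B ` set (fst c)"
  then obtain i where i: "i < length (fst c)" "y = B (fst c ! i)"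
    by (auto simp: in_set_conv_nth)
  then have y: "y = (snd c @ [0]) ! Suc i" using assms by (simp add: image_chain_def)
  show "y \<in> insert 0 (set (tl (snd c)))"
  proof (cases "Suc i < length (snd c)")
    case True
    then have "y = tl (snd c) ! i" "i < length (tl (snd c))" using y by (auto simp: nth_append nth_tl)
    then show ?thesis by auto
  next
    case False
    then have "Suc i = length (snd c)" using i assms by (auto simp: image_chain_def)
    then show ?thesis using y by (auto simp: nth_append)
  qed
qed

lemma image_chain_tl_subset:
  assumes "image_chain c"
  shows "set (tl (snd c)) \<subseteq> B ` set (fst c)"
proof
  fix y assume "y \<in> set (tl (snd c))"
  then obtain i where i: "Suc i < length (snd c)" "y = snd c ! Suc i"
    by (auto simp: in_set_conv_nth nth_tl less_diff_conv)
  then have "i < length (fst c)" "y = B (fst c ! i)"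
    using assms by (auto simp: image_chain_def nth_append)
  then show "y \<in> B ` set (fst c)" by auto
qed

definition extend_chain :: "('u list \<times> 'v list \<Rightarrow> 'u) \<Rightarrow> 'u list \<times> 'v list \<Rightarrow> 'u list \<times> 'v list" where
  "extend_chain g c = (g c # fst c, A (g c) # snd c)"

lemma image_chain_extend:
  assumes "image_chain c" "B (g c) = hd (snd c)"
  shows "image_chain (extend_chain g c)"
  using assms unfolding image_chain_def extend_chain_def
  by (auto simp: nth_Cons hd_conv_nth nth_append split: nat.splits)

lemma set_concat_extend:
  "set (concat (map fst (map (extend_chain g) cs))) = g ` set cs \<union> set (concat (map fst cs))"
  "set (concat (map snd (map (extend_chain g) cs))) = (\<lambda>c. A (g c)) ` set cs \<union> set (concat (map snd cs))"
  by (auto simp: extend_chain_def)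

lemma length_concat_extend:
  "length (concat (map fst (map (extend_chain g) cs))) = length cs + length (concat (map fst cs))"
  "length (concat (map snd (map (extend_chain g) cs))) = length cs + length (concat (map snd cs))"
  by (induction cs) (auto simp: extend_chain_def)

text \<open>The chains \<open>cs\<close> live in the next term \<open>(S', T')\<close>.
  \<open>g\<close> supplies their new first vectors, \<open>N\<close> starts the new square chains
  and \<open>F\<close> the new tall ones. The last equation counts the heads, a basis of
  \<open>T'\<close> modulo the image of \<open>S'\<close>; it yields the multiplicity of the square
  chains.\<close>

lemma image_step:
  assumes sub: "vs1.subspace S" "vs2.subspace T" "vs1.subspace S0" "vs2.subspace T0"
    and T': "T' = B ` S" and S': "S' = {u \<in> S. A u \<in> T'}"
    and AS: "A ` S \<subseteq> T" and BS: "B ` S \<subseteq> T"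
    and S0: "S0 \<subseteq> S'" and T0: "T0 \<subseteq> T'" "B ` S0 = T0"
    and ch: "\<And>c. c \<in> set cs \<Longrightarrow> image_chain c"
    and bS: "vs1.basis_mod S' S0 (concat (map fst cs))"
    and bT: "vs2.basis_mod T' T0 (concat (map snd cs))"
  shows "\<exists>g N F. (\<forall>c\<in>set cs. B (g c) = hd (snd c)) \<and> (\<forall>n\<in>set N. B n = 0) \<and>
     vs1.basis_mod S S' (map g cs @ N) \<and> vs2.basis_mod T T' (map (\<lambda>c. A (g c)) cs @ map A N @ F) \<and>
     vs2.dim (B ` S') + length cs = vs2.dim T'"
proof -
  define Y1 where "Y1 = map (\<lambda>c. hd (snd c)) cs"
  define Y2 where "Y2 = concat (map (\<lambda>c. tl (snd c)) cs)"
  define X where "X = concat (map fst cs)"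
  have sT': "vs2.subspace T'" unfolding T' using sub by (intro B.subspace_image)
  have "S' = S \<inter> {u. A u \<in> T'}" unfolding S' by auto
  then have sS': "vs1.subspace S'"
    using sub sT' by (simp add: vs1.subspace_inter A.subspace_linear_preimage)
  have "\<forall>c\<in>set cs. snd c \<noteq> []" using ch by (auto simp: image_chain_def)
  then have "set (concat (map snd cs)) = set (Y1 @ Y2) \<and> length (concat (map snd cs)) = length (Y1 @ Y2)"
    unfolding Y1_def Y2_def
  proof (induction cs)
    case (Cons c cs)
    then show ?case by (cases "snd c") auto
  qed simp
  then have bT': "vs2.basis_mod T' T0 (Y1 @ Y2)" using vs2.basis_mod_permute[OF bT] by simp
  \<comment> \<open>The tails span the image of \<open>S'\<close> under \<open>B\<close> modulo
    \<open>T0\<close>, and the splitting makes the heads \<open>Y1\<close> a basis of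
    \<open>T'\<close> modulo that image.\<close>
  define T'' where "T'' = vs2.span (T0 \<union> set Y2)"
  note spl = vs2.basis_mod_split[OF bT' sT' sub(4) T0(1), folded T''_def]
  have T'': "B ` S' = T''"
  proof -
    have "set X \<subseteq> S'" using bS by (simp add: vs1.basis_mod_def X_def)
    then have "S' = vs1.span (S0 \<union> set X)"
      using bS S0 sS' vs1.span_minimal[of "S0 \<union> set X" S'] unfolding vs1.basis_mod_def X_def
      by (meson Un_least subset_antisym)
    then have "B ` S' = vs2.span (T0 \<union> B ` set X)"
      using T0(2) by (simp add: B.span_image[symmetric] image_Un)
    also have "\<dots> = T''"
    proof -
      have "B ` set X \<subseteq> insert 0 (set Y2)"
        using ch image_chain_B_subset by (fastforce simp: X_def Y2_def)
      moreover have "set Y2 \<subseteq> B ` set X"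
        using ch image_chain_tl_subset by (fastforce simp: X_def Y2_def)
      moreover have "T0 \<union> insert 0 (set Y2) \<subseteq> T''"
        unfolding T''_def by (auto intro: vs2.span_base vs2.span_zero)
      ultimately have "T0 \<union> B ` set X \<subseteq> T''" "T0 \<union> set Y2 \<subseteq> vs2.span (T0 \<union> B ` set X)"
        by (blast, blast intro: vs2.span_base)
      then show ?thesis
        unfolding T''_def by (meson subset_antisym vs2.span_minimal vs2.subspace_span)
    qed
    finally show ?thesis .
  qed
  have "\<forall>c\<in>set cs. \<exists>u\<in>S. B u = hd (snd c)"
  proof
    fix c assume c: "c \<in> set cs"
    then have "hd (snd c) \<in> set Y1" by (simp add: Y1_def)
    then have "hd (snd c) \<in> T'" using bT' by (auto simp: vs2.basis_mod_def)
    then show "\<exists>u\<in>S. B u = hd (snd c)" unfolding T' by auto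
  qed
  then obtain g where g: "\<forall>c\<in>set cs. g c \<in> S \<and> B (g c) = hd (snd c)"
    by metis
  define E where "E = map g cs"
  have BE: "map B E = Y1" using g by (auto simp: E_def Y1_def)
  have ES: "set E \<subseteq> S" using g by (auto simp: E_def)
  have sT'': "vs2.subspace T''" by (simp add: T''_def)
  have Y1T: "vs2.indep_mod T'' Y1"
    using spl(1) vs2.basis_mod_iff_indep[OF sT' sT'' spl(3)] by blast
  \<comment> \<open>A relation among the preimages modulo \<open>S'\<close> would give one among the
    heads modulo \<open>T''\<close>.\<close>
  have iE: "vs1.indep_mod S' E"
    using indep_mod_of_map[OF linear_B, of T'' E S'] Y1T BE T'' by simp
  define Z where "Z = {u \<in> S. B u = 0}"
  \<comment> \<open>\<open>B u\<close> is a combination of heads up to some \<open>B s\<close> with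
    \<open>s\<close> in \<open>S'\<close>; subtracting \<open>s\<close> and the same combination of
    \<open>E\<close> from \<open>u\<close> leaves a vector killed by \<open>B\<close>. So kernel
    vectors suffice to complete \<open>E\<close>.\<close>
  have "S \<subseteq> vs1.span (S' \<union> set E \<union> Z)"
  proof
    fix u assume u: "u \<in> S"
    then have "B u \<in> vs2.span (T'' \<union> set Y1)" using spl(1) T' by (auto simp: vs2.basis_mod_def)
    then obtain c where "B u - vs2.lincomb c Y1 \<in> T''"
      using vs2.span_Un_lincomb_iff[OF sT''] by blast
    then obtain s where s: "s \<in> S'" "B u - B (vs1.lincomb c E) = B s"
      using lincomb_map[OF linear_B, of c E] BE T'' by auto
    have lE: "vs1.lincomb c E \<in> S" using vs1.lincomb_in_subspace[OF sub(1) ES] .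
    have "s \<in> S" using s S' by auto
    then have "u - vs1.lincomb c E - s \<in> Z"
      using u lE s(2) sub(1) by (auto simp: Z_def B.diff vs1.subspace_diff)
    then have z: "u - vs1.lincomb c E - s \<in> vs1.span (S' \<union> set E \<union> Z)" by (simp add: vs1.span_base)
    have "vs1.lincomb c E \<in> vs1.span (S' \<union> set E \<union> Z)"
      using vs1.lincomb_in_span vs1.span_mono[of "set E" "S' \<union> set E \<union> Z"] by blast
    moreover have "s \<in> vs1.span (S' \<union> set E \<union> Z)" using s by (simp add: vs1.span_base)
    ultimately have "(u - vs1.lincomb c E - s) + (vs1.lincomb c E + s) \<in> vs1.span (S' \<union> set E \<union> Z)"
      using z vs1.span_add by blast
    then show "u \<in> vs1.span (S' \<union> set E \<union> Z)" by simp
  qed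
  then obtain N where N: "set N \<subseteq> Z" "vs1.basis_mod S S' (E @ N)"
    using vs1.indep_mod_extend[OF sub(1) sS' _ ES iE, of Z] S' Z_def by auto
  have S'S: "S' \<subseteq> S" using S' by auto
  have T'T: "T' \<subseteq> T" using T' BS by auto
  have iEN: "vs1.indep_mod S' (E @ N)" using N(2) vs1.basis_mod_iff_indep[OF sub(1) sS' S'S] by blast
  have "set (E @ N) \<subseteq> S" using N(2) by (simp add: vs1.basis_mod_def)
  then have ENS: "vs1.span (set (E @ N)) \<subseteq> S" using sub(1) by (rule vs1.span_minimal)
  \<comment> \<open>\<open>S'\<close> is the whole preimage of \<open>T'\<close> in
    \<open>S\<close>, so \<open>A\<close> is injective from \<open>S\<close> modulo
    \<open>S'\<close> to \<open>T\<close> modulo \<open>T'\<close>.\<close>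
  have "vs2.indep_mod T' (map A (E @ N))"
    by (rule indep_mod_map[OF linear_A iEN]) (use ENS S' in auto)
  moreover have "set (map A (E @ N)) \<subseteq> T"
    using \<open>set (E @ N) \<subseteq> S\<close> AS by auto
  ultimately obtain F where "vs2.basis_mod T T' (map A (E @ N) @ F)"
    using vs2.indep_mod_extend[OF sub(2) sT' T'T, of "map A (E @ N)" T]
    by (auto intro: vs2.span_base)
  moreover have "vs2.dim (B ` S') + length cs = vs2.dim T'"
    using spl(1) T'' by (simp add: vs2.basis_mod_def Y1_def)
  ultimately show ?thesis
    using g N by (intro exI[of _ g] exI[of _ N] exI[of _ F]) (auto simp: E_def Z_def o_def)
qed

section \<open>Filtrations by images\<close>

definition image_filtration :: "(nat \<Rightarrow> 'u set) \<Rightarrow> (nat \<Rightarrow> 'v set) \<Rightarrow> bool" where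
  "image_filtration S T \<longleftrightarrow> vs1.subspace (S 0) \<and> vs2.subspace (T 0) \<and> A ` S 0 \<subseteq> T 0 \<and> B ` S 0 \<subseteq> T 0 \<and>
     (\<forall>n. T (Suc n) = B ` S n \<and> S (Suc n) = {u \<in> S n. A u \<in> B ` S n})"

text \<open>A filtration may start at any pair of subspaces that both maps respect, so it can be
  restarted one term later; the induction over the number of reductions rests on this.\<close>

lemma image_filtration_Suc:
  assumes "image_filtration S T"
  shows "image_filtration (\<lambda>n. S (Suc n)) (\<lambda>n. T (Suc n))"
proof -
  have "S (Suc 0) = S 0 \<inter> {u. A u \<in> T (Suc 0)}" "T (Suc 0) = B ` S 0"
    using assms by (auto simp: image_filtration_def)
  moreover from this have "vs2.subspace (T (Suc 0))" "vs1.subspace (S (Suc 0))"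
    using assms
    by (auto simp: image_filtration_def intro!: B.subspace_image vs1.subspace_inter A.subspace_linear_preimage)
  ultimately show ?thesis
    using assms unfolding image_filtration_def by auto
qed

lemma image_filtration_subspaces:
  assumes "image_filtration S T"
  shows "vs1.subspace (S n)" "vs2.subspace (T n)" "A ` S n \<subseteq> T n" "B ` S n \<subseteq> T n"
proof -
  have "image_filtration (\<lambda>k. S (k + n)) (\<lambda>k. T (k + n))"
    using assms by (induction n) (use image_filtration_Suc in force)+
  then show "vs1.subspace (S n)" "vs2.subspace (T n)" "A ` S n \<subseteq> T n" "B ` S n \<subseteq> T n"
    by (auto simp: image_filtration_def)
qed

lemma image_filtration_rec:
  assumes "image_filtration S T"
  shows "T (Suc n) = B ` S n" "S (Suc n) = {u \<in> S n. A u \<in> T (Suc n)}"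
  using assms by (auto simp: image_filtration_def)

lemma image_filtration_antimono:
  assumes "image_filtration S T" "m \<le> n"
  shows "S n \<subseteq> S m" "T n \<subseteq> T m"
proof -
  have "S (Suc k) \<subseteq> S k" "T (Suc k) \<subseteq> T k" for k
    using image_filtration_rec[OF assms(1), of k] image_filtration_subspaces(4)[OF assms(1), of k] by auto
  then show "S n \<subseteq> S m" "T n \<subseteq> T m"
    by (simp_all add: lift_Suc_antimono_le[OF _ assms(2)])
qed

text \<open>Indices start at 0 here, so these are the multiplicities of the blocks of size \<open>n + 1\<close>.\<close>

definition square_mult :: "(nat \<Rightarrow> 'u set) \<Rightarrow> (nat \<Rightarrow> 'v set) \<Rightarrow> nat \<Rightarrow> int" where
  "square_mult S T n = (int (vs1.dim (S n)) - int (vs1.dim (S (n + 1))))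
     - (int (vs2.dim (T (n + 1))) - int (vs2.dim (T (n + 2))))"

definition tall_mult :: "(nat \<Rightarrow> 'u set) \<Rightarrow> (nat \<Rightarrow> 'v set) \<Rightarrow> nat \<Rightarrow> int" where
  "tall_mult S T n = (int (vs2.dim (T n)) - int (vs2.dim (T (n + 1))))
     - (int (vs1.dim (S n)) - int (vs1.dim (S (n + 1))))"

text \<open>Induction on \<open>l\<close>: the chains of the filtration restarted at index 1 are
  lengthened by \<open>image_step\<close>, and chains of length one are added. The multiplicities at
  index 0 are the lengths of \<open>N\<close> and \<open>F\<close>, hence nonnegative.\<close>

theorem image_filtration_chains:
  assumes "image_filtration S T" "B ` S l = T l"
  shows "\<exists>cs ds.
     map (\<lambda>c. length (snd c)) cs = block_sizes (\<lambda>n. nat (square_mult S T n)) l \<and>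
     map (\<lambda>c. length (snd c)) ds = block_sizes (\<lambda>n. nat (tall_mult S T n)) l \<and>
     (\<forall>c\<in>set cs. image_chain c \<and> length (fst c) = length (snd c)) \<and>
     (\<forall>c\<in>set ds. image_chain c \<and> Suc (length (fst c)) = length (snd c)) \<and>
     vs1.basis_mod (S 0) (S l) (concat (map fst (ds @ cs))) \<and>
     vs2.basis_mod (T 0) (T l) (concat (map snd (ds @ cs))) \<and>
     (\<forall>n<l. 0 \<le> square_mult S T n \<and> 0 \<le> tall_mult S T n)"
  using assms
proof (induction l arbitrary: S T)
  case 0
  show ?case
    by (intro exI[of _ "[]"]) (simp add: vs1.basis_mod_self vs2.basis_mod_self)
next
  case (Suc l)
  note filt = Suc.prems(1)
  let ?S = "\<lambda>n. S (Suc n)" and ?T = "\<lambda>n. T (Suc n)"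
  obtain cs ds where IH:
     "map (\<lambda>c. length (snd c)) cs = block_sizes (\<lambda>n. nat (square_mult S T (Suc n))) l"
     "map (\<lambda>c. length (snd c)) ds = block_sizes (\<lambda>n. nat (tall_mult S T (Suc n))) l"
     "\<forall>c\<in>set cs. image_chain c \<and> length (fst c) = length (snd c)"
     "\<forall>c\<in>set ds. image_chain c \<and> Suc (length (fst c)) = length (snd c)"
     "vs1.basis_mod (S 1) (S (Suc l)) (concat (map fst (ds @ cs)))"
     "vs2.basis_mod (T 1) (T (Suc l)) (concat (map snd (ds @ cs)))"
     "\<forall>n<l. 0 \<le> square_mult S T (Suc n) \<and> 0 \<le> tall_mult S T (Suc n)"
    using Suc.IH[OF image_filtration_Suc[OF filt]] Suc.prems(2)
    by (auto simp: square_mult_def tall_mult_def)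
  note sub = image_filtration_subspaces[OF filt] and rec = image_filtration_rec[OF filt]
    and anti = image_filtration_antimono[OF filt]
  have "\<exists>g N F. (\<forall>c\<in>set (ds @ cs). B (g c) = hd (snd c)) \<and> (\<forall>n\<in>set N. B n = 0) \<and>
     vs1.basis_mod (S 0) (S 1) (map g (ds @ cs) @ N) \<and>
     vs2.basis_mod (T 0) (T 1) (map (\<lambda>c. A (g c)) (ds @ cs) @ map A N @ F) \<and>
     vs2.dim (B ` S 1) + length (ds @ cs) = vs2.dim (T 1)"
  proof (rule image_step[of "S 0" "T 0" "S (Suc l)" "T (Suc l)"])
    show "T 1 = B ` S 0" "S 1 = {u \<in> S 0. A u \<in> T 1}" using rec[of 0] by simp_all
    show "S (Suc l) \<subseteq> S 1" "T (Suc l) \<subseteq> T 1" using anti by simp_all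
    show "\<And>c. c \<in> set (ds @ cs) \<Longrightarrow> image_chain c" using IH by auto
  qed (use sub IH(5,6) Suc.prems(2) in simp_all)
  then obtain g N F where g: "\<forall>c\<in>set (ds @ cs). B (g c) = hd (snd c)" and N: "\<forall>n\<in>set N. B n = 0"
    and bS: "vs1.basis_mod (S 0) (S 1) (map g (ds @ cs) @ N)"
    and bT: "vs2.basis_mod (T 0) (T 1) (map (\<lambda>c. A (g c)) (ds @ cs) @ map A N @ F)"
    and len: "vs2.dim (B ` S 1) + length (ds @ cs) = vs2.dim (T 1)"
    by blast
  \<comment> \<open>A kernel vector \<open>n\<close> starts a square chain with \<open>A n\<close>;
    an element of \<open>F\<close> is a chain with no vector in \<open>U\<close>.\<close>
  define cs' where "cs' = map (\<lambda>n. ([n], [A n])) N @ map (extend_chain g) cs"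
  define ds' where "ds' = map (\<lambda>f. ([], [f])) F @ map (extend_chain g) ds"
  have T2: "T (Suc (Suc 0)) = B ` S 1" using rec(1)[of 1] by simp
  \<comment> \<open>From index 0 to 1 the dimension of \<open>S\<close> drops by the number of old
    chains plus \<open>length N\<close>; from index 1 to 2 that of \<open>T\<close> drops by the
    number of old chains alone.\<close>
  have sm: "square_mult S T 0 = int (length N)"
    using len bS T2 unfolding square_mult_def vs1.basis_mod_def by simp
  have tm: "tall_mult S T 0 = int (length F)"
    using bS bT unfolding tall_mult_def vs1.basis_mod_def vs2.basis_mod_def by simp
  \<comment> \<open>Lengthening interleaves new vectors with old ones, so the lists are compared by
    set and length only.\<close>
  have fst_set: "set (concat (map fst (ds' @ cs'))) = set ((map g (ds @ cs) @ N) @ concat (map fst (ds @ cs)))"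
    unfolding ds'_def cs'_def map_append concat_append set_append set_concat_extend by auto
  have snd_set: "set (concat (map snd (ds' @ cs'))) =
      set ((map (\<lambda>c. A (g c)) (ds @ cs) @ map A N @ F) @ concat (map snd (ds @ cs)))"
    unfolding ds'_def cs'_def map_append concat_append set_append set_concat_extend by auto
  have concat_singl: "concat (map (\<lambda>x. [h x]) xs) = map h xs" for h :: "'x \<Rightarrow> 'y" and xs
    by (induction xs) auto
  have fst_len: "length (concat (map fst (ds' @ cs'))) = length ((map g (ds @ cs) @ N) @ concat (map fst (ds @ cs)))"
    unfolding ds'_def cs'_def map_append concat_append length_append length_concat_extend
    by (simp add: o_def concat_singl map_replicate_const)
  have snd_len: "length (concat (map snd (ds' @ cs'))) =
      length ((map (\<lambda>c. A (g c)) (ds @ cs) @ map A N @ F) @ concat (map snd (ds @ cs)))"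
    unfolding ds'_def cs'_def map_append concat_append length_append length_concat_extend
    by (simp add: o_def concat_singl)
  have lens: "map (\<lambda>c. length (snd c)) (map (extend_chain g) xs) = map Suc (map (\<lambda>c. length (snd c)) xs)" for xs
    by (simp add: extend_chain_def)
  show ?case
  proof (rule exI[of _ cs'], rule exI[of _ ds'], intro conjI)
    show "map (\<lambda>c. length (snd c)) cs' = block_sizes (\<lambda>n. nat (square_mult S T n)) (Suc l)"
      unfolding block_sizes_Suc cs'_def map_append lens IH(1) sm by (simp add: o_def map_replicate_const)
    show "map (\<lambda>c. length (snd c)) ds' = block_sizes (\<lambda>n. nat (tall_mult S T n)) (Suc l)"
      unfolding block_sizes_Suc ds'_def map_append lens IH(2) tm by (simp add: o_def map_replicate_const)
    show "\<forall>c\<in>set cs'. image_chain c \<and> length (fst c) = length (snd c)"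
      using IH(3) N g unfolding cs'_def
      by (auto simp: image_chain_extend) (auto simp: image_chain_def extend_chain_def)
    show "\<forall>c\<in>set ds'. image_chain c \<and> Suc (length (fst c)) = length (snd c)"
      using IH(4) g unfolding ds'_def
      by (auto simp: image_chain_extend) (auto simp: image_chain_def extend_chain_def)
    show "vs1.basis_mod (S 0) (S (Suc l)) (concat (map fst (ds' @ cs')))"
      using vs1.basis_mod_trans[OF bS IH(5) anti(1)] fst_set fst_len vs1.basis_mod_permute by blast
    show "vs2.basis_mod (T 0) (T (Suc l)) (concat (map snd (ds' @ cs')))"
      using vs2.basis_mod_trans[OF bT IH(6) anti(2)] snd_set snd_len vs2.basis_mod_permute by blast
    show "\<forall>n<Suc l. 0 \<le> square_mult S T n \<and> 0 \<le> tall_mult S T n"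
      using IH(7) sm tm by (auto simp: less_Suc_eq_0_disj)
  qed
qed

text \<open>As long as \<open>B\<close> is not onto, the dimension of \<open>T n\<close> drops
  strictly. The index found here justifies the use of \<open>LEAST\<close> in \<open>ell1\<close>
  and \<open>ell2\<close>.\<close>

lemma image_filtration_stabilizes:
  assumes "image_filtration S T"
  shows "\<exists>l. B ` S l = T l"
proof (rule ccontr)
  assume *: "\<nexists>l. B ` S l = T l"
  note sub = image_filtration_subspaces[OF assms] and rec = image_filtration_rec[OF assms]
  have "vs2.dim (T (Suc n)) < vs2.dim (T n)" for n
  proof -
    have "T (Suc n) \<subset> T n" using * rec(1) sub(4)[of n] by auto
    then show ?thesis
      using vs2.subspace_dim_equal[OF sub(2) sub(2), of "Suc n" n] vs2.dim_subset[of "T (Suc n)" "T n"]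
      by (auto simp: not_le[symmetric])
  qed
  then have "vs2.dim (T n) + n \<le> vs2.dim (T 0)" for n
    by (induction n) (auto simp: Suc_le_eq intro: order.strict_trans2[OF add_strict_right_mono])
  from this[of "Suc (vs2.dim (T 0))"] show False by simp
qed

subsection \<open>Chains of the kernel filtration\<close>

text \<open>Modulo \<open>W\<close> such a chain gives \<open>(L_k, R_k)\<close> with
  \<open>k\<close> the length of its \<open>U\<close> part: the padding zeros are the images of the
  last vector under \<open>A\<close> and of the first under \<open>B\<close>.\<close>

definition kernel_chain :: "'v set \<Rightarrow> 'u list \<times> 'v list \<Rightarrow> bool" where
  "kernel_chain W c \<longleftrightarrow> length (fst c) = Suc (length (snd c)) \<and>
     (\<forall>i<length (fst c). A (fst c ! i) - (snd c @ [0]) ! i \<in> W \<and> B (fst c ! i) - (0 # snd c) ! i \<in> W)"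

text \<open>\<open>B\<close> induces an isomorphism from \<open>S\<close> modulo the preimage
  \<open>K\<close> of \<open>W\<close> onto \<open>T\<close> modulo \<open>W\<close>.\<close>

lemma basis_mod_map_B:
  assumes "vs1.basis_mod S K bs" "vs1.subspace S" "vs2.subspace W" "B ` S = T" "W \<subseteq> T"
    and K: "K = {u \<in> S. B u \<in> W}"
  shows "vs2.basis_mod T W (map B bs)"
proof -
  have "K = S \<inter> {u. B u \<in> W}" using K by auto
  then have sK: "vs1.subspace K" using assms by (simp add: vs1.subspace_inter B.subspace_linear_preimage)
  have KS: "K \<subseteq> S" using K by auto
  have bS: "set bs \<subseteq> S" using assms(1) by (simp add: vs1.basis_mod_def)
  have "vs2.indep_mod W (map B bs)"
  proof (rule indep_mod_map[OF linear_B])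
    show "vs1.indep_mod K bs" using assms(1) vs1.basis_mod_iff_indep[OF assms(2) sK KS] by blast
    show "x \<in> K" if "x \<in> vs1.span (set bs)" "B x \<in> W" for x
      using that vs1.span_minimal[OF bS assms(2)] K by auto
  qed
  moreover have "T \<subseteq> vs2.span (W \<union> set (map B bs))"
  proof -
    have "S \<subseteq> vs1.span (K \<union> set bs)" using assms(1) by (simp add: vs1.basis_mod_def)
    then have "T \<subseteq> vs2.span (B ` K \<union> B ` set bs)"
      unfolding assms(4)[symmetric] image_Un[symmetric] B.span_image by blast
    also have "\<dots> \<subseteq> vs2.span (W \<union> set (map B bs))"
      by (rule vs2.span_mono) (use K in auto)
    finally show ?thesis .
  qed
  moreover have "vs2.subspace T" using assms B.subspace_image by blast
  ultimately show ?thesis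
    using vs2.basis_mod_iff_indep[of T W] assms bS by auto
qed

lemma dim_preimage_B:
  assumes "vs1.subspace S" "vs2.subspace W" "B ` S = T" "W \<subseteq> T"
  shows "vs1.dim S + vs2.dim W = vs2.dim T + vs1.dim {u \<in> S. B u \<in> W}"
proof -
  let ?K = "{u \<in> S. B u \<in> W}"
  have "?K = S \<inter> {u. B u \<in> W}" by auto
  then have "vs1.subspace ?K" using assms by (simp add: vs1.subspace_inter B.subspace_linear_preimage)
  moreover have "S \<subseteq> vs1.span (?K \<union> S)" by (auto intro: vs1.span_base)
  ultimately obtain N where N: "vs1.basis_mod S ?K N"
    using vs1.basis_mod_extend[of S ?K S] assms by auto
  from N basis_mod_map_B[OF N assms refl] show ?thesis
    by (simp add: vs1.basis_mod_def vs2.basis_mod_def)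
qed

lemma subspace_add_image:
  assumes "vs2.subspace W" "vs1.subspace K"
  shows "vs2.subspace {w + A x | w x. w \<in> W \<and> x \<in> K}"
proof -
  have "{w + A x | w x. w \<in> W \<and> x \<in> K} = {w + y | w y. w \<in> W \<and> y \<in> A ` K}" by blast
  then show ?thesis using vs2.subspace_sums[OF assms(1) A.subspace_image[OF assms(2)]] by simp
qed

text \<open>The new \<open>V\<close> part consists of the images under \<open>B\<close> of the
  corrected old vectors. Up to \<open>W\<close>, the relation for \<open>A\<close> at
  \<open>xs ! i\<close> fails by some \<open>A x\<close> with \<open>x\<close> in \<open>K'\<close>;
  adding an element of \<open>K'\<close> to \<open>xs ! i\<close> repairs it and changes the image
  under \<open>B\<close> only within \<open>W\<close>.\<close>

lemma kernel_chain_lift: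
  assumes sW: "vs2.subspace W"
    and W': "W' = {w + A x | w x. w \<in> W \<and> x \<in> K'}" and BK': "B ` K' \<subseteq> W"
    and sK': "vs1.subspace K'" and sW': "vs2.subspace W'" and c: "kernel_chain W' c"
  shows "\<exists>d. length (fst d) = Suc (length (fst c)) \<and> kernel_chain W d \<and> hd (fst d) \<in> K' \<and>
     list_all2 (\<lambda>x' x. x' - x \<in> K') (tl (fst d)) (fst c) \<and> snd d = map B (tl (fst d)) \<and>
     A (hd (fst d)) - hd (snd d) \<in> W"
proof -
  have WW': "W \<subseteq> W'"
    using W' vs1.subspace_0[OF sK'] A.zero by force
  have W'E: "\<exists>x\<in>K'. A x - y \<in> W" if y: "y \<in> W'" for y
  proof -
    obtain w x where "y = w + A x" "w \<in> W" "x \<in> K'" using y unfolding W' by blast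
    then show ?thesis using vs2.subspace_neg[OF sW, of w] by (intro bexI[of _ x]) auto
  qed
  define xs ys where "xs = fst c" and "ys = snd c"
  have len: "length xs = Suc (length ys)" using c by (simp add: kernel_chain_def xs_def ys_def)
  have cA: "A (xs ! i) - (ys @ [0]) ! i \<in> W'" and cB: "B (xs ! i) - (0 # ys) ! i \<in> W'"
    if "i < length xs" for i
    using c that by (auto simp: kernel_chain_def xs_def ys_def)
  \<comment> \<open>\<open>t i\<close> is the value \<open>A\<close> should take on the i-th vector:
    the image under \<open>B\<close> of the next vector, and 0 at the end.\<close>
  define t where "t i = (if Suc i < length xs then B (xs ! Suc i) else 0)" for i
  have "A (xs ! i) - t i \<in> W'" if "i < length xs" for i
  proof (cases "Suc i < length xs")
    case True
    then have "A (xs ! i) - ys ! i \<in> W'" "B (xs ! Suc i) - ys ! i \<in> W'"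
      using cA[of i] cB[of "Suc i"] len by (auto simp: nth_append)
    from vs2.subspace_diff[OF sW' this] show ?thesis using True by (simp add: t_def)
  next
    case False
    then have "i = length ys" using that len by auto
    then show ?thesis using cA[of i] that False by (simp add: t_def nth_append)
  qed
  then have "\<exists>x\<in>K'. A x - (t i - A (xs ! i)) \<in> W" if "i < length xs" for i
    using W'E[of "t i - A (xs ! i)"] vs2.subspace_neg[OF sW', of "A (xs ! i) - t i"] that by simp
  then obtain k where k: "\<And>i. i < length xs \<Longrightarrow> k i \<in> K' \<and> A (k i) - (t i - A (xs ! i)) \<in> W"
    by metis
  define xs' where "xs' = map (\<lambda>i. xs ! i + k i) [0..<length xs]"
  have len': "length xs' = length xs" by (simp add: xs'_def)
  have diff: "list_all2 (\<lambda>x' x. x' - x \<in> K') xs' xs"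
    using k by (auto simp: xs'_def list_all2_conv_all_nth)
  have "A (xs' ! i) - (map B xs' @ [0]) ! Suc i \<in> W" if i: "i < length xs" for i
  proof (cases "Suc i < length xs")
    case True
    have "(A (k i) - (t i - A (xs ! i))) - B (k (Suc i)) \<in> W"
      by (rule vs2.subspace_diff[OF sW]) (use k[OF i] k[OF True] BK' in blast)+
    then show ?thesis using True i by (simp add: xs'_def t_def nth_append A.add B.add algebra_simps)
  next
    case False
    then have "Suc i = length xs" using i by simp
    then show ?thesis using k[OF i] i by (simp add: xs'_def t_def nth_append A.add algebra_simps)
  qed
  note A' = this
  \<comment> \<open>\<open>B\<close> sends the first old vector into \<open>W'\<close>, so up to
    \<open>W\<close> its image is reached by \<open>A\<close> from some \<open>e\<close> in
    \<open>K'\<close>; this \<open>e\<close> becomes the added first vector.\<close>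
  have "0 < length xs" using len by simp
  then have "B (xs' ! 0) \<in> W'"
    using cB[of 0] k[of 0] BK' WW' vs2.subspace_add[OF sW', of "B (xs ! 0)" "B (k 0)"]
    by (auto simp: xs'_def B.add)
  then obtain e where e: "e \<in> K'" "A e - B (xs' ! 0) \<in> W" using W'E by blast
  define d where "d = (e # xs', map B xs')"
  have "A (fst d ! i) - (snd d @ [0]) ! i \<in> W \<and> B (fst d ! i) - (0 # snd d) ! i \<in> W"
    if "i < length (fst d)" for i
  proof (cases i)
    case 0
    then show ?thesis using e BK' \<open>0 < length xs\<close> by (auto simp: d_def len' nth_append)
  next
    case (Suc n)
    then have n: "n < length xs" using that by (simp add: d_def len')
    then show ?thesis using A'[OF n] Suc vs2.subspace_0[OF sW] by (simp add: d_def len')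
  qed
  then have "kernel_chain W d" by (simp add: kernel_chain_def d_def)
  moreover have "A (hd (fst d)) - hd (snd d) \<in> W"
    using e \<open>0 < length xs\<close> len' by (cases xs') (auto simp: d_def)
  ultimately show ?thesis
    using e diff len' by (intro exI[of _ d]) (auto simp: d_def xs_def)
qed

lemma list_all2_concat_map:
  "(\<And>c. c \<in> set cs \<Longrightarrow> list_all2 R (f c) (g c)) \<Longrightarrow> list_all2 R (concat (map f cs)) (concat (map g cs))"
  by (induction cs) (auto intro: list_all2_appendI)

definition regular_part :: "'v set \<Rightarrow> 'u list \<Rightarrow> 'v list \<Rightarrow> 'f mat \<Rightarrow> bool" where
  "regular_part W us vs D \<longleftrightarrow> length us = length vs \<and>
     qmat sV A us vs (1\<^sub>m (length vs)) W \<and> qmat sV B us vs D W"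

text \<open>To preserve \<open>D\<close>, the list \<open>vs'\<close> is obtained by applying the
  inverse of \<open>D\<close> to the images of \<open>us\<close> under \<open>B\<close>. The
  relation for \<open>A\<close> then holds modulo \<open>W'\<close> and is repaired by elements of
  \<open>K'\<close>, which \<open>B\<close> sends into \<open>W\<close>. The span inclusions let
  \<open>vs'\<close> replace those images in a basis.\<close>

lemma regular_part_lift:
  assumes sW: "vs2.subspace W"
    and W': "W' = {w + A x | w x. w \<in> W \<and> x \<in> K'}" and BK': "B ` K' \<subseteq> W"
    and sW': "vs2.subspace W'"
    and reg: "regular_part W' us vs D" and D: "invertible_mat D"
  shows "\<exists>us' vs'. list_all2 (\<lambda>x' x. x' - x \<in> K') us' us \<and> regular_part W us' vs' D \<and>
     B ` set us \<subseteq> vs2.span (set vs') \<and> set vs' \<subseteq> vs2.span (B ` set us) \<and>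
     list_all2 (\<lambda>y' y. y' - y \<in> W') vs' vs"
proof -
  define n where "n = length us"
  have len: "length vs = n" and Aus: "\<And>i. i < n \<Longrightarrow> A (us ! i) - vs ! i \<in> W'"
    and Bus: "qmat sV B us vs D W'"
    using reg vs2.qmat_one[of us vs A W'] by (auto simp: regular_part_def n_def)
  have Dn: "D \<in> carrier_mat n n" using Bus len by (simp add: vs2.qmat_iff n_def)
  obtain D' where "inverts_mat D D'" "inverts_mat D' D" using D by (auto simp: invertible_mat_def)
  then have DD': "D * D' = 1\<^sub>m n" "D' * D = 1\<^sub>m (dim_row D')" using Dn by (auto simp: inverts_mat_def)
  have "dim_col D' = n" using arg_cong[OF DD'(1), of dim_col] by simp
  moreover have "dim_row D' = n" using arg_cong[OF DD'(2), of dim_col] Dn by simp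
  ultimately have D'n: "D' \<in> carrier_mat n n" by auto
  define bu where "bu = map B us"
  define vs' where "vs' = map (\<lambda>j. vs2.lincomb (\<lambda>i. D' $$ (i, j)) bu) [0..<n]"
  have lens: "length bu = n" "length vs' = n" by (simp_all add: bu_def vs'_def n_def)
  have q0: "qmat sV (\<lambda>x. x) vs' bu D' W" if "vs2.subspace W" for W
    using D'n lens that by (simp add: vs2.qmat_iff vs'_def vs2.subspace_0)
  have "qmat sV (\<lambda>x. x) bu vs D W'" using Bus by (simp add: vs2.qmat_iff bu_def)
  \<comment> \<open>Expressed in \<open>vs\<close> modulo \<open>W'\<close>, the list
    \<open>vs'\<close> has matrix \<open>D * D'\<close>, so both lists agree modulo
    \<open>W'\<close>.\<close>
  from vs2.qmat_compose_id[OF sW' q0[OF sW'] this] have "qmat sV (\<lambda>x. x) vs' vs (1\<^sub>m n) W'"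
    by (simp add: DD')
  then have vs'vs: "\<And>i. i < n \<Longrightarrow> vs' ! i - vs ! i \<in> W'"
    using vs2.qmat_one[of vs' vs "\<lambda>x. x" W'] len lens by simp
  have bu: "bu ! i = vs2.lincomb (\<lambda>j. D $$ (j, i)) vs'" if "i < n" for i
  proof -
    have "vs2.lincomb (\<lambda>j. D $$ (j, i)) vs' = vs2.lincomb (\<lambda>k. (D' * D) $$ (k, i)) bu"
      unfolding vs'_def vs2.lincomb_nested
      using D'n Dn that lens by (intro vs2.lincomb_cong) (auto simp: scalar_prod_def lessThan_atLeast0)
    also have "\<dots> = bu ! i"
      using D'n that lens DD' by (subst vs2.lincomb_delta[of _ _ i]) auto
    finally show ?thesis by simp
  qed
  have "\<exists>x\<in>K'. A (us ! i + x) - vs' ! i \<in> W" if "i < n" for i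
  proof -
    have "vs' ! i - A (us ! i) \<in> W'"
      using vs2.subspace_diff[OF sW' vs'vs[OF that] Aus[OF that]] by simp
    then obtain w x where "vs' ! i - A (us ! i) = w + A x" "w \<in> W" "x \<in> K'" unfolding W' by blast
    moreover from this have "A (us ! i + x) - vs' ! i = - w" by (simp add: A.add algebra_simps)
    ultimately show ?thesis using vs2.subspace_neg[OF sW] by metis
  qed
  then obtain k where k: "\<And>i. i < n \<Longrightarrow> k i \<in> K' \<and> A (us ! i + k i) - vs' ! i \<in> W" by metis
  define us' where "us' = map (\<lambda>i. us ! i + k i) [0..<n]"
  have "B (us' ! i) - vs2.lincomb (\<lambda>j. D $$ (j, i)) vs' \<in> W" if "i < n" for i
    using bu[OF that] k[OF that] BK' that by (auto simp: us'_def bu_def n_def B.add)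
  then have "regular_part W us' vs' D"
    using k Dn lens vs2.qmat_one[of us' vs' A W] by (auto simp: regular_part_def vs2.qmat_iff us'_def)
  moreover have "B ` set us \<subseteq> vs2.span (set vs')"
  proof -
    have "bu ! i \<in> vs2.span (set vs')" if "i < n" for i
      using bu[OF that] vs2.lincomb_in_span by simp
    then have "set bu \<subseteq> vs2.span (set vs')" using lens by (auto simp: in_set_conv_nth)
    then show ?thesis by (simp add: bu_def)
  qed
  moreover have "set vs' \<subseteq> vs2.span (B ` set us)"
    using vs2.lincomb_in_span[of _ bu] by (auto simp: vs'_def bu_def)
  ultimately show ?thesis
    using k vs'vs len lens by (intro exI[of _ us'] exI[of _ vs'])
      (auto simp: us'_def n_def list_all2_conv_all_nth)
qed

text \<open>\<open>dim K' - dim K\<close> counts the first vectors of all chains modulo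
  \<open>W\<close>, and the subtracted difference those of the lifted chains; so \<open>m\<close> is
  the number of new chains of type \<open>(L_1, R_1)\<close>.\<close>

lemma kernel_step:
  assumes sub: "vs1.subspace S" "vs2.subspace T" "vs1.subspace K" "vs2.subspace W"
    and AS: "A ` S = T" and BS: "B ` S = T" and KS: "K \<subseteq> S" and WT: "W \<subseteq> T"
    and AK: "A ` K \<subseteq> W" and BK: "B ` K \<subseteq> W"
    and K': "K' = {u \<in> S. B u \<in> W}" and W': "W' = {w + A x | w x. w \<in> W \<and> x \<in> K'}"
    and ch: "\<And>c. c \<in> set cs \<Longrightarrow> kernel_chain W' c"
    and bS: "vs1.basis_mod S K' (concat (map fst cs) @ us)"
    and bT: "vs2.basis_mod T W' (concat (map snd cs) @ vs)"
    and reg: "regular_part W' us vs D" and D: "invertible_mat D"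
    and m: "m = int (vs1.dim K') - int (vs1.dim K) - (int (vs1.dim {u \<in> S. B u \<in> W'}) - int (vs1.dim K'))"
  shows "\<exists>cs' us' vs'. 0 \<le> m \<and>
     map (\<lambda>c. length (fst c)) cs' = replicate (nat m) 1 @ map Suc (map (\<lambda>c. length (fst c)) cs) \<and>
     (\<forall>c\<in>set cs'. kernel_chain W c) \<and>
     vs1.basis_mod S K (concat (map fst cs') @ us') \<and>
     vs2.basis_mod T W (concat (map snd cs') @ vs') \<and> regular_part W us' vs' D"
proof -
  have "K' = S \<inter> {u. B u \<in> W}" using K' by auto
  then have sK': "vs1.subspace K'" using sub by (simp add: vs1.subspace_inter B.subspace_linear_preimage)
  have sW': "vs2.subspace W'" unfolding W' by (rule subspace_add_image[OF sub(4) sK'])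
  have KK': "K \<subseteq> K'" and K'S: "K' \<subseteq> S" and BK': "B ` K' \<subseteq> W" using K' KS BK by auto
  have WW': "W \<subseteq> W'" using vs1.subspace_0[OF sK'] A.zero unfolding W' by force
  have AK': "A ` K' \<subseteq> W'" using vs2.subspace_0[OF sub(4)] unfolding W' by force
  have W'T: "W' \<subseteq> T"
  proof -
    have "A x \<in> T" if "x \<in> K'" for x using that K'S AS by auto
    then show ?thesis using WT vs2.subspace_add[OF sub(2)] unfolding W' by blast
  qed

  have "\<forall>c\<in>set cs. \<exists>d. length (fst d) = Suc (length (fst c)) \<and> kernel_chain W d \<and> hd (fst d) \<in> K' \<and>
     list_all2 (\<lambda>x' x. x' - x \<in> K') (tl (fst d)) (fst c) \<and> snd d = map B (tl (fst d)) \<and>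
     A (hd (fst d)) - hd (snd d) \<in> W"
    using kernel_chain_lift[OF sub(4) W' BK' sK' sW'] ch by blast
  then obtain G where G: "\<And>c. c \<in> set cs \<Longrightarrow> length (fst (G c)) = Suc (length (fst c)) \<and> kernel_chain W (G c) \<and>
     hd (fst (G c)) \<in> K' \<and> list_all2 (\<lambda>x' x. x' - x \<in> K') (tl (fst (G c))) (fst c) \<and>
     snd (G c) = map B (tl (fst (G c))) \<and> A (hd (fst (G c))) - hd (snd (G c)) \<in> W"
    by metis
  obtain us' vs' where lift: "list_all2 (\<lambda>x' x. x' - x \<in> K') us' us" "regular_part W us' vs' D"
     "B ` set us \<subseteq> vs2.span (set vs')" "set vs' \<subseteq> vs2.span (B ` set us)"
     "list_all2 (\<lambda>y' y. y' - y \<in> W') vs' vs"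
    using regular_part_lift[OF sub(4) W' BK' sW' reg D] by blast

  \<comment> \<open>\<open>X\<close> holds the corrected old vectors and \<open>E\<close> the added
    first ones; the heads \<open>Y1\<close> will span \<open>W'\<close> modulo
    \<open>W\<close>.\<close>
  define X where "X = concat (map (\<lambda>c. tl (fst (G c))) cs)"
  define E where "E = map (\<lambda>c. hd (fst (G c))) cs"
  define Y1 where "Y1 = map (\<lambda>c. hd (snd (G c))) cs"
  define Y2 where "Y2 = concat (map (\<lambda>c. tl (snd (G c))) cs)"
  have X: "list_all2 (\<lambda>x' x. x' - x \<in> K') X (concat (map fst cs))"
    unfolding X_def using G by (intro list_all2_concat_map) blast
  have bX: "vs1.basis_mod S K' (X @ us)"
    by (rule vs1.basis_mod_perturb[OF bS _ sub(1) sK' K'S])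
      (use X vs1.subspace_0[OF sK'] in \<open>auto intro!: list_all2_appendI list_all2_refl\<close>)
  have bXu: "vs1.basis_mod S K' (X @ us')"
    by (rule vs1.basis_mod_perturb[OF bS _ sub(1) sK' K'S])
      (use X lift(1) in \<open>auto intro!: list_all2_appendI\<close>)

  have Gne: "snd (G c) \<noteq> []" "fst (G c) \<noteq> []" "length (snd (G c)) = length (fst c)"
    "length (fst c) = Suc (length (snd c))" if "c \<in> set cs" for c
    using G[OF that] ch[OF that] by (auto simp: kernel_chain_def)
  have Y: "set (concat (map (\<lambda>c. snd (G c)) cs)) = set (Y1 @ Y2)"
      "length (concat (map (\<lambda>c. snd (G c)) cs)) = length (Y1 @ Y2)" "length Y2 = length (concat (map snd cs))"
      "set (concat (map (\<lambda>c. fst (G c)) cs)) = set (E @ X)"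
      "length (concat (map (\<lambda>c. fst (G c)) cs)) = length (E @ X)"
    using Gne unfolding Y1_def Y2_def E_def X_def
  proof (induction cs)
    case (Cons c cs)
    { case 1 then show ?case using Cons by (cases "snd (G c)") auto }
    { case 2 then show ?case using Cons by (cases "snd (G c)") auto }
    { case 3
      have "length (tl (snd (G c))) = length (snd c)" using 3(3,4)[of c] by simp
      then show ?case using 3 Cons.IH by auto }
    { case 4 then show ?case using Cons by (cases "fst (G c)") auto }
    { case 5 then show ?case using Cons by (cases "fst (G c)") auto }
  qed simp_all
  have YX: "concat (map (\<lambda>c. snd (G c)) cs) = map B X"
    unfolding X_def map_concat map_map o_def using G by (metis (no_types, lifting) map_cong)

  have lv: "length vs' = length us" "length vs = length us"
    using reg lift by (auto simp: regular_part_def dest: list_all2_lengthD)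
  \<comment> \<open>The isomorphism induced by \<open>B\<close> carries the basis
    \<open>X @ us\<close> to a basis of \<open>T\<close> modulo \<open>W\<close>, in which
    \<open>vs'\<close> may replace the images of \<open>us\<close>.\<close>
  have bY: "vs2.basis_mod T W (map B X @ vs')"
  proof -
    have b: "vs2.basis_mod T W (map B (X @ us))"
      by (rule basis_mod_map_B[OF bX sub(1,4) BS WT K'])
    have "T \<subseteq> vs2.span (W \<union> set (map B (X @ us)))" using b by (simp add: vs2.basis_mod_def)
    also have "\<dots> \<subseteq> vs2.span (W \<union> set (map B X @ vs'))"
    proof (rule vs2.span_minimal)
      have "B ` set us \<subseteq> vs2.span (W \<union> set (map B X @ vs'))"
        using lift(3) vs2.span_mono[of "set vs'" "W \<union> set (map B X @ vs')"] by auto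
      moreover have "W \<union> set (map B X) \<subseteq> vs2.span (W \<union> set (map B X @ vs'))"
        by (auto intro: vs2.span_base)
      ultimately show "W \<union> set (map B (X @ us)) \<subseteq> vs2.span (W \<union> set (map B X @ vs'))" by auto
    qed simp
    finally have sp: "T \<subseteq> vs2.span (W \<union> set (map B X @ vs'))" .
    have "set (map B (X @ us)) \<subseteq> T" using b by (simp add: vs2.basis_mod_def)
    moreover from this have "vs2.span (B ` set us) \<subseteq> T" using sub(2) by (intro vs2.span_minimal) auto
    ultimately show ?thesis using b sp lift(4) lv by (auto simp: vs2.basis_mod_def)
  qed
  have bY': "vs2.basis_mod T W ((Y2 @ vs') @ Y1)"
    by (rule vs2.basis_mod_permute[OF bY]) (use Y YX in auto)
  note spl = vs2.basis_mod_split[OF bY' sub(2,4) WT]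
  \<comment> \<open>A head agrees modulo \<open>W\<close> with \<open>A e\<close> for a first vector
    \<open>e\<close> in \<open>K'\<close>.\<close>
  have "Y1 ! i \<in> W'" if "i < length cs" for i
  proof -
    have c: "cs ! i \<in> set cs" using that by simp
    have "A (hd (fst (G (cs ! i)))) \<in> W'" using G[OF c] AK' by auto
    moreover have "A (hd (fst (G (cs ! i)))) - hd (snd (G (cs ! i))) \<in> W'" using G[OF c] WW' by blast
    ultimately have "A (hd (fst (G (cs ! i)))) - (A (hd (fst (G (cs ! i)))) - hd (snd (G (cs ! i)))) \<in> W'"
      by (rule vs2.subspace_diff[OF sW'])
    then show ?thesis using that by (simp add: Y1_def)
  qed
  then have "set Y1 \<subseteq> W'" by (metis Y1_def in_set_conv_nth length_map subsetI)
  then have "vs2.span (W \<union> set Y1) \<subseteq> W'" using WW' sW' by (intro vs2.span_minimal) auto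
  \<comment> \<open>Both subspaces have the same codimension in \<open>T\<close>, since the bases
    modulo them have equal length.\<close>
  moreover have "vs2.dim W' = vs2.dim (vs2.span (W \<union> set Y1))"
    using spl(1) bT Y(3) lv unfolding vs2.basis_mod_def by simp
  ultimately have W'Y: "vs2.span (W \<union> set Y1) = W'"
    using vs2.subspace_dim_equal[OF vs2.subspace_span sW'] by simp
  \<comment> \<open>\<open>A\<close> maps \<open>E\<close> to the heads up to \<open>W\<close>. As
    \<open>A\<close> maps \<open>K\<close> into \<open>W\<close>, independence of the images modulo
    \<open>W\<close> makes \<open>E\<close> independent modulo \<open>K\<close>.\<close>
  have AE: "vs2.basis_mod W' W (map A E)"
  proof (rule vs2.basis_mod_perturb[OF spl(2)[unfolded W'Y] _ sW' sub(4) WW'])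
    show "list_all2 (\<lambda>b' b. b' - b \<in> W) (map A E) Y1"
      unfolding E_def Y1_def map_map o_def list_all2_map1 list_all2_map2 list_all2_same using G by blast
  qed
  then have "vs2.indep_mod W (map A E)" using vs2.basis_mod_iff_indep[OF sW' sub(4) WW'] by blast
  then have iE: "vs1.indep_mod K E" using indep_mod_of_map[OF linear_A _ AK] by blast
  define Z where "Z = {u \<in> K'. A u \<in> W}"
  have EK': "set E \<subseteq> K'" using G by (auto simp: E_def)
  have "K' \<subseteq> vs1.span (K \<union> set E \<union> Z)"
  proof
    fix u assume u: "u \<in> K'"
    then have "A u \<in> vs2.span (W \<union> set (map A E))"
      using AE AK' unfolding vs2.basis_mod_def by blast
    then obtain c where c: "A u - vs2.lincomb c (map A E) \<in> W"
      using vs2.span_Un_lincomb_iff[OF sub(4)] by blast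
    have "u - vs1.lincomb c E \<in> Z"
      using c u vs1.lincomb_in_subspace[OF sK' EK'] vs1.subspace_diff[OF sK']
      by (simp add: Z_def lincomb_map[OF linear_A] A.diff)
    then have "u - vs1.lincomb c E \<in> vs1.span (K \<union> set E \<union> Z)" by (simp add: vs1.span_base)
    moreover have "vs1.lincomb c E \<in> vs1.span (K \<union> set E \<union> Z)"
      using vs1.lincomb_in_span vs1.span_mono[of "set E" "K \<union> set E \<union> Z"] by blast
    ultimately have "(u - vs1.lincomb c E) + vs1.lincomb c E \<in> vs1.span (K \<union> set E \<union> Z)"
      by (rule vs1.span_add)
    then show "u \<in> vs1.span (K \<union> set E \<union> Z)" by simp
  qed
  then obtain N where N: "set N \<subseteq> Z" "vs1.basis_mod K' K (E @ N)"
    using vs1.indep_mod_extend[OF sK' sub(3) KK' EK' iE, of Z] Z_def by blast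

  \<comment> \<open>Both maps send each \<open>n\<close> in \<open>N\<close> into \<open>W\<close>,
    so \<open>n\<close> alone is a chain with empty \<open>V\<close> part, the 0 x 1 block.\<close>
  define cs' where "cs' = map (\<lambda>n. ([n], [])) N @ map G cs"
  have concat_singl: "concat (map (\<lambda>x. [h x]) xs) = map h xs" for h :: "'u \<Rightarrow> 'u" and xs
    by (induction xs) auto
  have fst_cs': "concat (map fst cs') = N @ concat (map (\<lambda>c. fst (G c)) cs)"
    unfolding cs'_def by (simp add: o_def concat_singl[of "\<lambda>x. x", simplified])
  have snd_cs': "concat (map snd cs') = map B X"
    unfolding cs'_def using YX by (simp add: o_def)
  have bS': "vs1.basis_mod S K (concat (map fst cs') @ us')"
    by (rule vs1.basis_mod_permute[OF vs1.basis_mod_trans[OF bXu N(2) K'S]])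
      (use Y(4,5) in \<open>auto simp: fst_cs'\<close>)
  have lX: "length X = length (concat (map snd cs)) + length cs"
    using Y(2,3) arg_cong[OF YX, of length] by (simp add: Y1_def)
  have "vs1.dim S = vs1.dim K' + length X + length us" "vs2.dim T = vs2.dim W' + length (concat (map snd cs)) + length vs"
    using bX bT by (auto simp: vs1.basis_mod_def vs2.basis_mod_def)
  \<comment> \<open>The preimage of \<open>W'\<close> exceeds \<open>K'\<close> in dimension by one
    for each old chain, because its \<open>U\<close> part is one longer than its \<open>V\<close>
    part.\<close>
  then have "vs1.dim {u \<in> S. B u \<in> W'} = vs1.dim K' + length cs"
    using dim_preimage_B[OF sub(1) sW' BS W'T] lX lv by simp
  moreover have "vs1.dim K' = vs1.dim K + length cs + length N"
    using N(2) by (simp add: vs1.basis_mod_def E_def)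
  ultimately have mN: "m = int (length N)" unfolding m by simp
  show ?thesis
  proof (rule exI[of _ cs'], rule exI[of _ us'], rule exI[of _ vs'], intro conjI)
    show "0 \<le> m" using mN by simp
    show "map (\<lambda>c. length (fst c)) cs' = replicate (nat m) 1 @ map Suc (map (\<lambda>c. length (fst c)) cs)"
      using G by (simp add: mN cs'_def o_def map_replicate_const)
    have "kernel_chain W ([n], [])" if "n \<in> set N" for n
      using that N(1) BK' by (auto simp: kernel_chain_def Z_def)
    then show "\<forall>c\<in>set cs'. kernel_chain W c"
      using G by (auto simp: cs'_def)
    show "vs2.basis_mod T W (concat (map snd cs') @ vs')" using bY snd_cs' by simp
  qed (use bS' lift(2) in auto)
qed

section \<open>Filtrations by kernels\<close>

definition kernel_filtration :: "'u set \<Rightarrow> 'v set \<Rightarrow> (nat \<Rightarrow> 'u set) \<Rightarrow> (nat \<Rightarrow> 'v set) \<Rightarrow> bool" where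
  "kernel_filtration S T K W \<longleftrightarrow> vs1.subspace S \<and> vs2.subspace T \<and> vs1.subspace (K 0) \<and> vs2.subspace (W 0) \<and>
     A ` S = T \<and> B ` S = T \<and> K 0 \<subseteq> S \<and> W 0 \<subseteq> T \<and> A ` K 0 \<subseteq> W 0 \<and> B ` K 0 \<subseteq> W 0 \<and>
     (\<forall>n. K (Suc n) = {u \<in> S. B u \<in> W n} \<and> W (Suc n) = {w + A x | w x. w \<in> W n \<and> x \<in> K (Suc n)})"

text \<open>Quotients are encoded by keeping \<open>S\<close> and \<open>T\<close> fixed while the
  subspaces divided out grow. The first such pair may be nonzero, so the sequence can be restarted
  one term later.\<close>

lemma kernel_filtration_Suc:
  assumes "kernel_filtration S T K W"
  shows "kernel_filtration S T (\<lambda>n. K (Suc n)) (\<lambda>n. W (Suc n))" "K 0 \<subseteq> K (Suc 0)"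
proof -
  have sub: "vs1.subspace S" "vs2.subspace T" "vs1.subspace (K 0)" "vs2.subspace (W 0)"
    and inc: "A ` S = T" "B ` S = T" "K 0 \<subseteq> S" "W 0 \<subseteq> T" "A ` K 0 \<subseteq> W 0" "B ` K 0 \<subseteq> W 0"
    and rec: "\<And>n. K (Suc n) = {u \<in> S. B u \<in> W n}"
      "\<And>n. W (Suc n) = {w + A x | w x. w \<in> W n \<and> x \<in> K (Suc n)}"
    using assms by (simp_all only: kernel_filtration_def)
  have "K (Suc 0) = S \<inter> {u. B u \<in> W 0}" using rec(1) by auto
  then have sK: "vs1.subspace (K (Suc 0))"
    using sub by (simp add: vs1.subspace_inter B.subspace_linear_preimage)
  have sW: "vs2.subspace (W (Suc 0))"
    unfolding rec(2)[of 0] by (rule subspace_add_image[OF sub(4) sK])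
  have AK: "A ` K (Suc 0) \<subseteq> W (Suc 0)" using vs2.subspace_0[OF sub(4)] unfolding rec(2)[of 0] by force
  have WW: "W 0 \<subseteq> W (Suc 0)" using vs1.subspace_0[OF sK] A.zero unfolding rec(2)[of 0] by force
  have WT: "W (Suc 0) \<subseteq> T"
  proof -
    have "A x \<in> T" if "x \<in> K (Suc 0)" for x using that inc(1) rec(1) by auto
    then show ?thesis using inc(4) vs2.subspace_add[OF sub(2)] unfolding rec(2)[of 0] by blast
  qed
  have BK: "B ` K (Suc 0) \<subseteq> W (Suc 0)" and KS: "K (Suc 0) \<subseteq> S" using rec(1)[of 0] WW by auto
  show "kernel_filtration S T (\<lambda>n. K (Suc n)) (\<lambda>n. W (Suc n))"
    unfolding kernel_filtration_def
    by (intro conjI allI) (rule sub sK sW inc AK WT BK KS rec)+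
  show "K 0 \<subseteq> K (Suc 0)" using inc rec(1) by auto
qed

lemma kernel_filtration_shift:
  assumes "kernel_filtration S T K W"
  shows "kernel_filtration S T (\<lambda>k. K (k + n)) (\<lambda>k. W (k + n))"
  using assms by (induction n) (use kernel_filtration_Suc in force)+

definition wide_mult :: "'u set \<Rightarrow> (nat \<Rightarrow> 'u set) \<Rightarrow> nat \<Rightarrow> int" where
  "wide_mult S K n = (int (vs1.dim S) - int (vs1.dim (K n))) - 2 * (int (vs1.dim S) - int (vs1.dim (K (n + 1))))
     + (int (vs1.dim S) - int (vs1.dim (K (n + 2))))"

text \<open>Induction on \<open>l\<close> along the restarted filtration: the given regular part
  sits at the last term, and \<open>kernel_step\<close> lifts it back to index 0 with the same
  \<open>D\<close>, adding chains of length one at each stage.\<close>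

theorem kernel_filtration_chains:
  assumes "kernel_filtration S T K W" "invertible_mat D" "regular_part (W l) us vs D"
    and "vs1.basis_mod S (K l) us" "vs2.basis_mod T (W l) vs"
  shows "\<exists>cs us' vs'.
     map (\<lambda>c. length (fst c)) cs = block_sizes (\<lambda>n. nat (wide_mult S K n)) l \<and>
     (\<forall>c\<in>set cs. kernel_chain (W 0) c) \<and>
     vs1.basis_mod S (K 0) (concat (map fst cs) @ us') \<and>
     vs2.basis_mod T (W 0) (concat (map snd cs) @ vs') \<and>
     regular_part (W 0) us' vs' D \<and> (\<forall>n<l. 0 \<le> wide_mult S K n)"
  using assms
proof (induction l arbitrary: K W)
  case 0
  then show ?case
    by (intro exI[of _ "[]"] exI[of _ us] exI[of _ vs]) simp
next
  case (Suc l)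
  note filt = Suc.prems(1)
  obtain cs us1 vs1 where IH:
     "map (\<lambda>c. length (fst c)) cs = block_sizes (\<lambda>n. nat (wide_mult S K (Suc n))) l"
     "\<forall>c\<in>set cs. kernel_chain (W (Suc 0)) c"
     "vs1.basis_mod S (K (Suc 0)) (concat (map fst cs) @ us1)"
     "vs2.basis_mod T (W (Suc 0)) (concat (map snd cs) @ vs1)"
     "regular_part (W (Suc 0)) us1 vs1 D" "\<forall>n<l. 0 \<le> wide_mult S K (Suc n)"
    using Suc.IH[OF kernel_filtration_Suc(1)[OF filt] Suc.prems(2-5)]
    by (auto simp: wide_mult_def)
  have K2: "K (Suc (Suc 0)) = {u \<in> S. B u \<in> W (Suc 0)}"
    using filt by (auto simp: kernel_filtration_def)
  have m: "wide_mult S K 0 = int (vs1.dim (K (Suc 0))) - int (vs1.dim (K 0))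
     - (int (vs1.dim {u \<in> S. B u \<in> W (Suc 0)}) - int (vs1.dim (K (Suc 0))))"
    unfolding wide_mult_def K2[symmetric] by simp
  have "\<exists>cs' us' vs'. 0 \<le> wide_mult S K 0 \<and>
     map (\<lambda>c. length (fst c)) cs' = replicate (nat (wide_mult S K 0)) 1 @ map Suc (map (\<lambda>c. length (fst c)) cs) \<and>
     (\<forall>c\<in>set cs'. kernel_chain (W 0) c) \<and>
     vs1.basis_mod S (K 0) (concat (map fst cs') @ us') \<and>
     vs2.basis_mod T (W 0) (concat (map snd cs') @ vs') \<and> regular_part (W 0) us' vs' D"
    by (rule kernel_step[OF _ _ _ _ _ _ _ _ _ _ _ _ _ IH(3,4,5) Suc.prems(2) m])
      (use filt IH(2) in \<open>auto simp: kernel_filtration_def\<close>)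
  then show ?case
    unfolding block_sizes_Suc IH(1) using IH(6) by (auto simp: less_Suc_eq_0_disj)
qed

subsection \<open>The regularizing decomposition\<close>

lemma image_filtration_step1:
  assumes "vs1.subspace S" "vs2.subspace T" "A ` S \<subseteq> T" "B ` S \<subseteq> T"
  shows "image_filtration (\<lambda>n. fst ((step1 A B ^^ n) (S, T))) (\<lambda>n. snd ((step1 A B ^^ n) (S, T)))"
  using assms unfolding image_filtration_def by (simp add: step1_def split_beta)

text \<open>The second form serves chains built with the two maps exchanged.\<close>

lemma gives_pair_square_chain:
  assumes "image_chain c" "length (fst c) = length (snd c)"
  shows "vs2.gives_pair A B (fst c) (snd c) (1\<^sub>m (length (snd c)), Jmat (length (snd c)))"
    "vs2.gives_pair B A (fst c) (snd c) (Jmat (length (snd c)), 1\<^sub>m (length (snd c)))"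
  using assms vs2.qmat_one[of "fst c" "snd c" A "{0}"] vs2.qmat_Jmat[of "fst c" "snd c" B]
  by (auto simp: vs2.gives_pair_def image_chain_def)

lemma gives_pair_tall_chain:
  assumes "image_chain c" "Suc (length (fst c)) = length (snd c)"
  shows "vs2.gives_pair A B (fst c) (snd c)
    (transpose_mat (Lmat (length (snd c))), transpose_mat (Rmat (length (snd c))))"
  using assms vs2.qmat_transpose_Lmat[of "snd c" "fst c" A] vs2.qmat_transpose_Rmat[of "snd c" "fst c" B]
  by (auto simp: vs2.gives_pair_def image_chain_def nth_append)

lemma gives_pair_kernel_chain:
  assumes "kernel_chain {0} c"
  shows "vs2.gives_pair A B (fst c) (snd c) (Lmat (length (fst c)), Rmat (length (fst c)))"
  using assms vs2.qmat_Lmat[of "fst c" "snd c" A] vs2.qmat_Rmat[of "fst c" "snd c" B]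
  by (simp add: vs2.gives_pair_def kernel_chain_def)

text \<open>\<open>S\<close> and \<open>R\<close> are change-of-basis matrices. Both sides of each
  intertwining relation represent the same map from \<open>es\<close> to \<open>fs'\<close> and
  agree by uniqueness.\<close>

lemma pair_equiv_of_bases:
  assumes "vs1.basis_mod UNIV {0} es" "vs2.basis_mod UNIV {0} fs"
    and "vs1.basis_mod UNIV {0} es'" "vs2.basis_mod UNIV {0} fs'"
    and M: "vs2.gives_pair A B es fs M" and A'B': "qmat sV A es' fs' A' {0}" "qmat sV B es' fs' B' {0}"
  shows "pair_equiv M (A', B')"
proof -
  obtain S where S: "qmat sV (\<lambda>x. x) fs fs' S {0}" "invertible_mat S"
    using vs2.change_of_basis[OF assms(2,4)] by auto
  obtain R where R: "qmat sU (\<lambda>x. x) es es' R {0}" "invertible_mat R"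
    using vs1.change_of_basis[OF assms(1,3)] by auto
  obtain MA MB where MAB: "M = (MA, MB)" by fastforce
  have qM: "qmat sV A es fs MA {0}" "qmat sV B es fs MB {0}"
    using M MAB by (simp_all add: vs2.gives_pair_def)
  have "S * MA = A' * R"
    by (rule vs2.qmat_unique[OF assms(4) vs2.subspace_UNIV vs2.subspace_single_0 subset_UNIV
      vs2.qmat_compose_id[OF vs2.subspace_single_0 qM(1) S(1)]
      qmat_compose[OF linear_A vs2.subspace_single_0 _ R(1) A'B'(1)]]) (simp add: A.zero)
  moreover have "S * MB = B' * R"
    by (rule vs2.qmat_unique[OF assms(4) vs2.subspace_UNIV vs2.subspace_single_0 subset_UNIV
      vs2.qmat_compose_id[OF vs2.subspace_single_0 qM(2) S(1)]
      qmat_compose[OF linear_B vs2.subspace_single_0 _ R(1) A'B'(2)]]) (simp add: B.zero)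
  moreover have "MA \<in> carrier_mat (length fs) (length es)" "MB \<in> carrier_mat (length fs) (length es)"
    "A' \<in> carrier_mat (length fs') (length es')" "B' \<in> carrier_mat (length fs') (length es')"
    "S \<in> carrier_mat (length fs') (length fs)" "R \<in> carrier_mat (length es') (length es)"
    using qM A'B' S R by (auto simp: qmat_def)
  ultimately show ?thesis
    using S R MAB unfolding pair_equiv_def by auto
qed

lemma kernel_filtration_facts:
  assumes "kernel_filtration S T K W"
  shows "vs1.subspace (K n)" "vs2.subspace (W n)" "K n \<subseteq> S" "W n \<subseteq> T" "A ` K n \<subseteq> W n" "B ` K n \<subseteq> W n"
    "K n \<subseteq> K (Suc n)"
  using kernel_filtration_shift[OF assms, of n] kernel_filtration_Suc(2)[OF kernel_filtration_shift[OF assms, of n]]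
  by (simp_all add: kernel_filtration_def)

lemma kernel_filtration_stabilizes:
  assumes "kernel_filtration S T K W"
  shows "\<exists>l. K (Suc l) = K l"
proof (rule ccontr)
  assume *: "\<nexists>l. K (Suc l) = K l"
  note facts = kernel_filtration_facts[OF assms]
  have "vs1.dim (K n) < vs1.dim (K (Suc n))" for n
    using vs1.subspace_dim_equal[OF facts(1) facts(1) facts(7), of n] * by (metis not_le)
  then have "n \<le> vs1.dim (K n)" for n
    by (induction n) (auto simp: Suc_le_eq intro: order.strict_trans1)
  moreover have "vs1.dim (K n) \<le> vs1.dim S" for n using facts(3) by (rule vs1.dim_subset)
  ultimately show False by (metis Suc_n_not_le_n order.trans)
qed

text \<open>Once \<open>K\<close> stops growing, \<open>K l\<close> is the preimage of
  \<open>W l\<close>, so \<open>B\<close> is an isomorphism of the quotients, and so is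
  \<open>A\<close>, being onto between equal dimensions. With \<open>map A us\<close> as target
  basis \<open>A\<close> becomes the identity and \<open>B\<close> a change of basis
  \<open>D\<close>.\<close>

lemma regular_part_exists:
  assumes "kernel_filtration S T K W" "K (Suc l) = K l"
  shows "\<exists>us vs D. vs1.basis_mod S (K l) us \<and> vs2.basis_mod T (W l) vs \<and>
    regular_part (W l) us vs D \<and> invertible_mat D"
proof -
  note facts = kernel_filtration_facts[OF assms(1)]
  have sub: "vs1.subspace S" "vs2.subspace T" and img: "A ` S = T" "B ` S = T"
    and Kl: "K l = {u \<in> S. B u \<in> W l}"
    using assms by (simp_all add: kernel_filtration_def)
  have "S \<subseteq> vs1.span (K l \<union> S)" by (auto intro: vs1.span_base)
  then obtain us where us: "vs1.basis_mod S (K l) us"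
    using vs1.basis_mod_extend[OF sub(1) facts(1,3) order_refl] by blast
  have bB: "vs2.basis_mod T (W l) (map B us)"
    by (rule basis_mod_map_B[OF us sub(1) facts(2) img(2) facts(4) Kl])
  have "S \<subseteq> vs1.span (K l \<union> set us)" using us by (simp add: vs1.basis_mod_def)
  then have "T \<subseteq> vs2.span (A ` K l \<union> A ` set us)"
    unfolding img(1)[symmetric] image_Un[symmetric] A.span_image by blast
  also have "\<dots> \<subseteq> vs2.span (W l \<union> set (map A us))"
    using facts(5) by (intro vs2.span_mono) auto
  finally have bA: "vs2.basis_mod T (W l) (map A us)"
    using bB us img by (auto simp: vs2.basis_mod_def vs1.basis_mod_def)
  obtain D where D: "qmat sV (\<lambda>x. x) (map B us) (map A us) D (W l)" "invertible_mat D"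
    using vs2.change_of_basis[OF bB bA sub(2) facts(2,4)] by blast
  have "regular_part (W l) us (map A us) D"
    using D(1) vs2.subspace_0[OF facts(2)] vs2.qmat_one[of us "map A us" A]
    by (simp add: regular_part_def vs2.qmat_iff)
  then show ?thesis using us bA D(2) by blast
qed

lemma kernel_filtration_step3:
  assumes "vs1.subspace (U3base A B)" "vs2.subspace (V3base A B)"
    "A ` U3base A B = V3base A B" "B ` U3base A B = V3base A B"
  shows "kernel_filtration (U3base A B) (V3base A B)
    (\<lambda>n. fst ((step3 A B ^^ n) ({0}, {0}))) (\<lambda>n. snd ((step3 A B ^^ n) ({0}, {0})))"
  using assms vs1.subspace_0 vs2.subspace_0 unfolding kernel_filtration_def
  by (simp add: step3_def Let_def split_beta A.zero B.zero)

end

theorem theorem2: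
  fixes sU :: "'f::field \<Rightarrow> 'u::ab_group_add \<Rightarrow> 'u"
    and sV :: "'f \<Rightarrow> 'v::ab_group_add \<Rightarrow> 'v"
    and A B :: "'u \<Rightarrow> 'v"
  assumes "\<exists>BU. finite_dimensional_vector_space sU BU"
    and "\<exists>BV. finite_dimensional_vector_space sV BV"
    and "Vector_Spaces.linear sU sV A"
    and "Vector_Spaces.linear sU sV B"
  shows "(\<forall>j. 1 \<le> j \<and> j < ell1 A B \<longrightarrow> 0 \<le> mult_LRT sU sV A B j \<and> 0 \<le> mult_IJ sU sV A B j)
    \<and> (\<forall>j. 1 \<le> j \<and> j < ell2 A B \<longrightarrow> 0 \<le> mult_JI sV A B j)
    \<and> (\<forall>j. 1 \<le> j \<and> j < ell3 A B \<longrightarrow> 0 \<le> mult_LR sU A B j)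
    \<and> (\<exists>es fs D us vs.
         qbasis sU UNIV {0} es \<and> qbasis sV UNIV {0} fs
       \<and> qmat sV A es fs (fst (pair_dsum (1\<^sub>m (dim_row D), D) (pair_dsum_list (sing_blocks sU sV A B)))) {0}
       \<and> qmat sV B es fs (snd (pair_dsum (1\<^sub>m (dim_row D), D) (pair_dsum_list (sing_blocks sU sV A B)))) {0}
       \<and> invertible_mat D
       \<and> qbasis sU (U3base A B) (fst (Q3 A B (ell3 A B))) us
       \<and> qbasis sV (V3base A B) (snd (Q3 A B (ell3 A B))) vs
       \<and> qmat sV A us vs (1\<^sub>m (dim_row D)) (snd (Q3 A B (ell3 A B)))
       \<and> qmat sV B us vs D (snd (Q3 A B (ell3 A B)))
       \<and> (\<forall>es' fs' A' B'. qbasis sU UNIV {0} es' \<and> qbasis sV UNIV {0} fs'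
             \<and> qmat sV A es' fs' A' {0} \<and> qmat sV B es' fs' B' {0}
             \<longrightarrow> regularizing_decomposition (A', B') D (sing_blocks sU sV A B)))"
proof -
  obtain BU BV where "finite_dimensional_vector_space sU BU" "finite_dimensional_vector_space sV BV"
    using assms by blast
  then interpret linear_pencil sU BU sV BV A B
    using assms by (intro linear_pencil.intro linear_pencil_axioms.intro finite_dimensional_vector_space_pair.intro)
  \<comment> \<open>Exchanging the maps makes the results on the first sequence available for the
    second.\<close>
  interpret swap: linear_pencil sU BU sV BV B A
    by unfold_locales

  define S1 T1 where "S1 n = fst ((step1 A B ^^ n) (UNIV, UNIV))"
    and "T1 n = snd ((step1 A B ^^ n) (UNIV, UNIV))" for n
  have filt1: "image_filtration S1 T1"
    unfolding S1_def T1_def by (rule image_filtration_step1) auto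
  \<comment> \<open>\<open>p\<close> is the number of reductions: sequences indexed from 0 are one
    behind \<open>P1\<close>, and likewise for \<open>q\<close> and \<open>r\<close> below.\<close>
  define p where "p = ell1 A B - 1"
  have P1: "P1 A B (Suc n) = (S1 n, T1 n)" for n by (simp add: P1_def S1_def T1_def)
  obtain k where "B ` S1 k = T1 k" using image_filtration_stabilizes[OF filt1] by blast
  then have "1 \<le> Suc k \<and> B ` fst (P1 A B (Suc k)) = snd (P1 A B (Suc k))" by (simp add: P1)
  then have "1 \<le> ell1 A B \<and> B ` fst (P1 A B (ell1 A B)) = snd (P1 A B (ell1 A B))"
    unfolding ell1_def by (rule LeastI)
  then have p: "ell1 A B = Suc p" "B ` S1 p = T1 p"
    using P1[of p] by (auto simp: p_def)
  have mult1: "mult_IJ sU sV A B (Suc n) = square_mult S1 T1 n" "mult_LRT sU sV A B (Suc n) = tall_mult S1 T1 n" for n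
    by (simp_all add: mult_IJ_def mult_LRT_def square_mult_def tall_mult_def dU1_def dV1_def P1)

  define S2 T2 where "S2 n = fst ((step1 B A ^^ n) (S1 p, T1 p))"
    and "T2 n = snd ((step1 B A ^^ n) (S1 p, T1 p))" for n
  have filt2: "swap.image_filtration S2 T2"
    unfolding S2_def T2_def
    by (rule swap.image_filtration_step1) (use image_filtration_subspaces[OF filt1] in auto)
  note sub2 = swap.image_filtration_subspaces[OF filt2]
  have rec2: "T2 (Suc n) = A ` S2 n" "S2 (Suc n) = {u \<in> S2 n. B u \<in> T2 (Suc n)}" for n
    using swap.image_filtration_rec[OF filt2] by auto
  define q where "q = ell2 A B - 1"
  have "step2 A B = step1 B A" by (simp add: step2_def step1_def)
  then have P2: "P2 A B (Suc n) = (S2 n, T2 n)" for n by (simp add: P2_def S2_def T2_def p P1)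
  obtain k where "A ` S2 k = T2 k" using swap.image_filtration_stabilizes[OF filt2] by blast
  then have "1 \<le> Suc k \<and> A ` fst (P2 A B (Suc k)) = snd (P2 A B (Suc k))" by (simp add: P2)
  then have "1 \<le> ell2 A B \<and> A ` fst (P2 A B (ell2 A B)) = snd (P2 A B (ell2 A B))"
    unfolding ell2_def by (rule LeastI)
  then have q: "ell2 A B = Suc q" "A ` S2 q = T2 q"
    using P2[of q] by (auto simp: q_def)
  \<comment> \<open>\<open>B\<close> starts onto and stays so: the source is cut down to the full
    preimage of the new target.\<close>
  have BS2: "B ` S2 n = T2 n" for n
  proof (induction n)
    case 0
    then show ?case using p by (simp add: S2_def T2_def)
  next
    case (Suc n)
    have sub: "T2 (Suc n) \<subseteq> B ` S2 n"
      unfolding Suc by (rule swap.image_filtration_antimono[OF filt2]) simp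
    have "B ` {u \<in> S2 n. B u \<in> Y} = Y" if "Y \<subseteq> B ` S2 n" for Y using that by auto
    from this[OF sub] show ?case unfolding rec2(2)[of n] .
  qed
  \<comment> \<open>Surjectivity of \<open>B\<close> makes the dimensions of both spaces drop
    equally. So no transposed blocks arise, and the square multiplicity becomes the second
    difference \<open>mult_JI\<close>.\<close>
  have tall2: "swap.tall_mult S2 T2 n = 0" for n
  proof -
    have "T2 (Suc n) \<subseteq> T2 n" using swap.image_filtration_antimono[OF filt2, of n "Suc n"] by simp
    from dim_preimage_B[OF sub2(1) sub2(2) BS2 this] show ?thesis
      by (simp add: swap.tall_mult_def rec2(2))
  qed
  have mult2: "mult_JI sV A B (Suc n) = swap.square_mult S2 T2 n" for n
    using tall2[of n] by (simp add: mult_JI_def swap.square_mult_def swap.tall_mult_def dV2_def P2)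

  have base3: "U3base A B = S2 q" "V3base A B = T2 q"
    using P2[of q] by (simp_all add: U3base_def V3base_def q)
  define K W where "K n = fst ((step3 A B ^^ n) ({0}, {0}))"
    and "W n = snd ((step3 A B ^^ n) ({0}, {0}))" for n
  have filt3: "kernel_filtration (S2 q) (T2 q) K W"
    unfolding base3[symmetric] K_def W_def
    by (rule kernel_filtration_step3) (use base3 sub2 q BS2 in auto)
  note facts3 = kernel_filtration_facts[OF filt3]
  have Q3: "Q3 A B (Suc n) = (K n, W n)" for n by (simp add: Q3_def K_def W_def)
  define r where "r = ell3 A B - 1"
  have Ksuc: "K (Suc n) = {u \<in> S2 q. B u \<in> W n}" for n
    using filt3 by (simp add: kernel_filtration_def)
  \<comment> \<open>As \<open>B\<close> is already onto, bijectivity on the quotients amounts to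
    injectivity, that is, to \<open>K\<close> having stopped growing.\<close>
  have quot: "quot_bij B (S2 q) (K n) (T2 q) (W n) \<longleftrightarrow> K (Suc n) = K n" for n
  proof -
    have "\<forall>v\<in>T2 q. \<exists>u\<in>S2 q. B u - v \<in> W n"
    proof
      fix v assume "v \<in> T2 q"
      then obtain u where "u \<in> S2 q" "v = B u" using BS2 by blast
      then show "\<exists>u\<in>S2 q. B u - v \<in> W n"
        using vs2.subspace_0[OF facts3(2)] by (intro bexI[of _ u]) auto
    qed
    then show ?thesis using facts3(7)[of n] unfolding quot_bij_def Ksuc by blast
  qed
  obtain k where "K (Suc k) = K k" using kernel_filtration_stabilizes[OF filt3] by blast
  then have "1 \<le> Suc k \<and> quot_bij B (U3base A B) (fst (Q3 A B (Suc k))) (V3base A B) (snd (Q3 A B (Suc k)))"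
    by (simp add: Q3 base3 quot)
  then have least: "1 \<le> ell3 A B \<and>
      quot_bij B (U3base A B) (fst (Q3 A B (ell3 A B))) (V3base A B) (snd (Q3 A B (ell3 A B)))"
    unfolding ell3_def by (rule LeastI)
  then have r: "ell3 A B = Suc r" by (simp add: r_def)
  have Kr: "K (Suc r) = K r"
    using least unfolding r Q3 base3 fst_conv snd_conv quot by blast
  have mult3: "mult_LR sU A B (Suc n) = wide_mult (S2 q) K n" for n
    by (simp add: mult_LR_def wide_mult_def dU3_def base3 Q3)

  \<comment> \<open>Chains from the three sequences and their assembly\<close>
  obtain cs1 ds1 where c1:
     "map (\<lambda>c. length (snd c)) cs1 = block_sizes (\<lambda>n. nat (square_mult S1 T1 n)) p"
     "map (\<lambda>c. length (snd c)) ds1 = block_sizes (\<lambda>n. nat (tall_mult S1 T1 n)) p"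
     "\<And>c. c \<in> set cs1 \<Longrightarrow> image_chain c \<and> length (fst c) = length (snd c)"
     "\<And>c. c \<in> set ds1 \<Longrightarrow> image_chain c \<and> Suc (length (fst c)) = length (snd c)"
     "vs1.basis_mod (S1 0) (S1 p) (concat (map fst (ds1 @ cs1)))"
     "vs2.basis_mod (T1 0) (T1 p) (concat (map snd (ds1 @ cs1)))"
     "\<And>n. n < p \<Longrightarrow> 0 \<le> square_mult S1 T1 n \<and> 0 \<le> tall_mult S1 T1 n"
    using image_filtration_chains[OF filt1 p(2)]
    by (elim exE conjE) (rule that, (assumption | blast)+)
  obtain cs2 ds2 where c2:
     "map (\<lambda>c. length (snd c)) cs2 = block_sizes (\<lambda>n. nat (swap.square_mult S2 T2 n)) q"
     "map (\<lambda>c. length (snd c)) ds2 = block_sizes (\<lambda>n. nat (swap.tall_mult S2 T2 n)) q"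
     "\<And>c. c \<in> set cs2 \<Longrightarrow> swap.image_chain c \<and> length (fst c) = length (snd c)"
     "vs1.basis_mod (S2 0) (S2 q) (concat (map fst (ds2 @ cs2)))"
     "vs2.basis_mod (T2 0) (T2 q) (concat (map snd (ds2 @ cs2)))"
     "\<And>n. n < q \<Longrightarrow> 0 \<le> swap.square_mult S2 T2 n"
    using swap.image_filtration_chains[OF filt2 q(2)]
    by (elim exE conjE) (rule that, (assumption | blast)+)
  have ds2: "ds2 = []" using c2(2) by (simp add: tall2 block_sizes_eq_Nil)
  \<comment> \<open>\<open>us\<close> and \<open>vs\<close> are bases of the final quotients;
    \<open>us'\<close> and \<open>vs'\<close> below carry the same \<open>D\<close> up to the
    subspaces \<open>S2 q\<close> and \<open>T2 q\<close>.\<close>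
  obtain us vs D where reg: "vs1.basis_mod (S2 q) (K r) us" "vs2.basis_mod (T2 q) (W r) vs"
    "regular_part (W r) us vs D" "invertible_mat D"
    using regular_part_exists[OF filt3 Kr] by blast
  obtain cs3 us' vs' where c3:
     "map (\<lambda>c. length (fst c)) cs3 = block_sizes (\<lambda>n. nat (wide_mult (S2 q) K n)) r"
     "\<And>c. c \<in> set cs3 \<Longrightarrow> kernel_chain (W 0) c"
     "vs1.basis_mod (S2 q) (K 0) (concat (map fst cs3) @ us')"
     "vs2.basis_mod (T2 q) (W 0) (concat (map snd cs3) @ vs')"
     "regular_part (W 0) us' vs' D" "\<And>n. n < r \<Longrightarrow> 0 \<le> wide_mult (S2 q) K n"
    using kernel_filtration_chains[OF filt3 reg(4,3,1,2)]
    by (elim exE conjE) (rule that, (assumption | blast)+)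

  have start: "S1 0 = UNIV" "T1 0 = UNIV" "S2 0 = S1 p" "T2 0 = T1 p" "K 0 = {0}" "W 0 = {0}"
    by (simp_all add: S1_def T1_def S2_def T2_def K_def W_def)
  \<comment> \<open>The chains follow the order of \<open>sing_blocks\<close>, with the regular part
    in front in both bases.\<close>
  define cs where "cs = ds1 @ cs1 @ cs2 @ cs3"
  define es where "es = us' @ concat (map fst cs)"
  define fs where "fs = vs' @ concat (map snd cs)"
  have les: "S2 q \<subseteq> S1 p" "T2 q \<subseteq> T1 p"
    using swap.image_filtration_antimono[OF filt2, of 0 q] start by auto
  \<comment> \<open>The partial bases are glued along \<open>UNIV\<close> \<supseteq>
    \<open>S1 p\<close> \<supseteq> \<open>S2 q\<close> \<supseteq> \<open>{0}\<close> and then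
    reordered.\<close>
  have bes: "vs1.basis_mod UNIV {0} es"
    by (rule vs1.basis_mod_permute[OF vs1.basis_mod_trans[OF c1(5)[unfolded start]
        vs1.basis_mod_trans[OF c2(4)[unfolded start] c3(3)[unfolded start] les(1)] subset_UNIV]])
      (auto simp: es_def cs_def ds2)
  have bfs: "vs2.basis_mod UNIV {0} fs"
    by (rule vs2.basis_mod_permute[OF vs2.basis_mod_trans[OF c1(6)[unfolded start]
        vs2.basis_mod_trans[OF c2(5)[unfolded start] c3(4)[unfolded start] les(2)] subset_UNIV]])
      (auto simp: fs_def cs_def ds2)
  have blocks: "sing_blocks sU sV A B =
      map (\<lambda>c. (transpose_mat (Lmat (length (snd c))), transpose_mat (Rmat (length (snd c))))) ds1 @
      map (\<lambda>c. (1\<^sub>m (length (snd c)), Jmat (length (snd c)))) cs1 @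
      map (\<lambda>c. (Jmat (length (snd c)), 1\<^sub>m (length (snd c)))) cs2 @
      map (\<lambda>c. (Lmat (length (fst c)), Rmat (length (fst c)))) cs3"
    (is "_ = ?Ps")
  proof -
    have sizes: "map (\<lambda>c. h (length (snd c))) xs = map h (map (\<lambda>c. length (snd c)) xs)"
      "map (\<lambda>c. h (length (fst c))) xs = map h (map (\<lambda>c. length (fst c)) xs)"
      for h :: "nat \<Rightarrow> 'f mat \<times> 'f mat" and xs :: "('u list \<times> 'v list) list"
      by simp_all
    have l: "1 \<le> Suc n" for n by simp
    show ?thesis
      unfolding sing_blocks_def p(1) q(1) r concat_replicate_block_sizes[OF l] mult1 mult2 mult3 diff_Suc_1
        sizes[of "\<lambda>k. (transpose_mat (Lmat k), transpose_mat (Rmat k))"]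
        sizes[of "\<lambda>k. (1\<^sub>m k, Jmat k)"] sizes[of "\<lambda>k. (Jmat k, 1\<^sub>m k)"]
        sizes[of "\<lambda>k. (Lmat k, Rmat k)"] c1(1,2) c2(1) c3(1) ..
  qed
  have "list_all2 (\<lambda>c P. vs2.gives_pair A B (fst c) (snd c) P) cs ?Ps"
    unfolding cs_def
    using c1(3,4) c2(3) c3(2) start(6)
    by (intro list_all2_appendI)
      (simp_all add: list_all2_map2 list_all2_same gives_pair_tall_chain gives_pair_square_chain
        swap.gives_pair_square_chain gives_pair_kernel_chain)
  then have "vs2.gives_pair A B (concat (map fst cs)) (concat (map snd cs)) (pair_dsum_list (sing_blocks sU sV A B))"
    unfolding blocks by (rule vs2.gives_pair_dsum_list)
  moreover have rows: "dim_row D = length vs'" "dim_row D = length vs" "D \<in> carrier_mat (dim_row D) (dim_row D)"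
    using c3(5) reg(3) by (auto simp: regular_part_def qmat_def)
  moreover have "vs2.gives_pair A B us' vs' (1\<^sub>m (dim_row D), D)"
    using c3(5) unfolding vs2.gives_pair_def regular_part_def start rows(1) by simp
  ultimately have given: "vs2.gives_pair A B es fs
      (pair_dsum (1\<^sub>m (dim_row D), D) (pair_dsum_list (sing_blocks sU sV A B)))"
    unfolding es_def fs_def by (intro vs2.gives_pair_dsum)
  have canonical: "\<forall>b\<in>set (sing_blocks sU sV A B). canonical_block b"
    by (force simp: sing_blocks_def canonical_block_def)
  have qU: "qbasis sU UNIV {0} xs \<longleftrightarrow> vs1.basis_mod UNIV {0} xs" for xs
    by (rule vs1.qbasis_iff_basis_mod) auto
  have qV: "qbasis sV UNIV {0} xs \<longleftrightarrow> vs2.basis_mod UNIV {0} xs" for xs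
    by (rule vs2.qbasis_iff_basis_mod) auto
  have decomp: "regularizing_decomposition (A', B') D (sing_blocks sU sV A B)"
    if "qbasis sU UNIV {0} es'" "qbasis sV UNIV {0} fs'"
      "qmat sV A es' fs' A' {0}" "qmat sV B es' fs' B' {0}" for es' fs' A' B'
    unfolding regularizing_decomposition_def
    using rows(3) reg(4) canonical pair_equiv_of_bases[OF bes bfs _ _ given that(3,4)] that(1,2) qU qV
    by blast
  have mults: "\<forall>j. 1 \<le> j \<and> j < ell1 A B \<longrightarrow> 0 \<le> mult_LRT sU sV A B j \<and> 0 \<le> mult_IJ sU sV A B j"
    "\<forall>j. 1 \<le> j \<and> j < ell2 A B \<longrightarrow> 0 \<le> mult_JI sV A B j"
    "\<forall>j. 1 \<le> j \<and> j < ell3 A B \<longrightarrow> 0 \<le> mult_LR sU A B j"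
  proof safe
    fix j :: nat
    assume "1 \<le> j"
    then obtain n where n: "j = Suc n" by (cases j) auto
    { assume "j < ell1 A B"
      then show "0 \<le> mult_LRT sU sV A B j" "0 \<le> mult_IJ sU sV A B j"
        using c1(7)[of n] by (simp_all add: n mult1 p) }
    { assume "j < ell2 A B"
      then show "0 \<le> mult_JI sV A B j" using c2(6)[of n] by (simp add: n mult2 q) }
    { assume "j < ell3 A B"
      then show "0 \<le> mult_LR sU A B j" using c3(6)[of n] by (simp add: n mult3 r) }
  qed
  have "qbasis sU (U3base A B) (fst (Q3 A B (ell3 A B))) us"
    using reg(1) vs1.qbasis_iff_basis_mod[OF sub2(1) facts3(1,3)] by (simp add: base3 r Q3)
  moreover have "qbasis sV (V3base A B) (snd (Q3 A B (ell3 A B))) vs"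
    using reg(2) vs2.qbasis_iff_basis_mod[OF sub2(2) facts3(2,4)] by (simp add: base3 r Q3)
  moreover have "qmat sV A us vs (1\<^sub>m (dim_row D)) (snd (Q3 A B (ell3 A B)))"
    "qmat sV B us vs D (snd (Q3 A B (ell3 A B)))"
    using reg(3) unfolding regular_part_def r Q3 snd_conv rows(2) by blast+
  ultimately show ?thesis
    using mults bes bfs given reg(4) decomp unfolding qU qV vs2.gives_pair_def by blast
qed

end
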